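(* Let $e\ge 2$ be an integer, $p$ a prime and $r\ge 1$ an integer with $p^r\equiv 1 \pmod e$. Fix a generator $\gamma$ of $\mathbb{F}_{p^r}^\times$, let $n\ge 1$ be an integer, and fix a generator $\lambda$ of $\mathbb{F}_{p^{nr}}^\times$ such that $\mathrm{Nr}(\lambda)\gamma^{-1}$ is an $e$-th power in $\mathbb{F}_{p^r}^\times$, where $\mathrm{Nr}:\mathbb{F}_{p^{nr}}\to\mathbb{F}_{p^r}$ is the norm. Let $C_r$ be the multiplication matrix of the Gaussian periods of degree $e$ for $\mathbb{F}_{p^r}$ with respect to $\gamma$, and $C_{nr}$ that for $\mathbb{F}_{p^{nr}}$ with respect to $\lambda$. Then \[ C_{nr}=(-1)^{n-1}C_r^{(n)}, \] where $C_r^{(n)}=C_r\overset{-1}{\ast}\cdots\overset{-1}{\ast}C_r$ ($n$ factors). In particular $P_{e,nr}(X)=\mathrm{Char}_X\big((-1)^{n-1}C_r^{(n)}\big)$, where $P_{e,nr}(X)=\prod_{i=0}^{e-1}(X-\eta_{nr}(i))$ and $\mathrm{Char}_X$ denotes the characteristic polynomial.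
   Context: For a prime power $q=p^m$ with $q\equiv1\pmod e$, write $q=ef+1$, let $\zeta_p=e^{2\pi i/p}$, $\mathrm{Tr}:\mathbb{F}_q\to\mathbb{F}_p$ the trace, and $\beta$ a generator of $\mathbb{F}_q^\times$. Gaussian periods: $\eta(i)=\sum_{j=0}^{f-1}\zeta_p^{\mathrm{Tr}(\beta^{ej+i})}$, $i\in\mathbb{Z}/e\mathbb{Z}$. Cyclotomic numbers: for $0\le i,j\le e-1$, $\mathrm{Cyc}(i,j)=\#\{(v_1,v_2):0\le v_1,v_2\le f-1,\ 1+\beta^{ev_1+i}=\beta^{ev_2+j}\text{ in }\mathbb{F}_q\}$. Let $D_i=1$ if $-1\in\beta^{i}(\mathbb{F}_q^\times)^e$ and $D_i=0$ otherwise. The multiplication matrix is the $e\times e$ matrix $C=[\mathrm{Cyc}(i,j)-D_if]_{0\le i,j\le e-1}$ (it satisfies $\eta(m)\eta(m+i)=\sum_j(\mathrm{Cyc}(i,j)-D_if)\eta(m+j)$). For $e\times e$ matrices $A=[a_{i,j}]$, $B=[b_{i,j}]$ (indices in $\mathbb{Z}/e\mathbb{Z}$) and $d\in(\mathbb{Z}/e\mathbb{Z})\setminus\{0\}$, the $d$-composition is $A\overset{d}{\ast}B=\big[\sum_{s=0}^{e-1}\sum_{t=0}^{e-1}a_{s,t}b_{ds+i,dt+j}\big]_{0\le i,j\le e-1}$; the $(-1)$-composition is associative, so the $n$-fold product is well defined. *)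

theory Defs
  imports Complex_Main "Jordan_Normal_Form.Char_Poly"
begin

text \<open>All fields of characteristic p considered here are realised inside one ambient
finite field K with |K| = p^(n r).  For m dividing n r, the field F_(p^m) is the unique
subfield of K of order p^m, namely the set of roots of X^(p^m) - X.\<close>

definition subfield_pm :: "nat \<Rightarrow> nat \<Rightarrow> 'K::{finite,field} set" where
  "subfield_pm p m = {x. x ^ (p ^ m) = x}"

definition is_generator :: "nat \<Rightarrow> nat \<Rightarrow> 'K::{finite,field} \<Rightarrow> bool" where
  "is_generator p m \<beta> \<longleftrightarrow> \<beta> \<in> subfield_pm p m \<and> range (\<lambda>k::nat. \<beta> ^ k) = subfield_pm p m - {0}"

definition trace_pm :: "nat \<Rightarrow> nat \<Rightarrow> 'K::{finite,field} \<Rightarrow> 'K" where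
  "trace_pm p m x = (\<Sum>k<m. x ^ (p ^ k))"

text \<open>Norm F_(p^(n r)) -> F_(p^r) (product of the Galois conjugates).\<close>
definition norm_rel :: "nat \<Rightarrow> nat \<Rightarrow> nat \<Rightarrow> 'K::{finite,field} \<Rightarrow> 'K" where
  "norm_rel p r n x = (\<Prod>k<n. x ^ (p ^ (r * k)))"

definition to_Zp :: "nat \<Rightarrow> 'K::{finite,field} \<Rightarrow> nat" where
  "to_Zp p y = (THE j. j < p \<and> of_nat j = y)"

definition f_of :: "nat \<Rightarrow> nat \<Rightarrow> nat \<Rightarrow> nat" where
  "f_of p m e = (p ^ m - 1) div e"

definition gauss_period :: "nat \<Rightarrow> nat \<Rightarrow> nat \<Rightarrow> 'K::{finite,field} \<Rightarrow> nat \<Rightarrow> complex" where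
  "gauss_period p m e \<beta> i =
     (\<Sum>j<f_of p m e. cis (2 * pi * real (to_Zp p (trace_pm p m (\<beta> ^ (e * j + i)))) / real p))"

definition period_poly :: "nat \<Rightarrow> nat \<Rightarrow> nat \<Rightarrow> 'K::{finite,field} \<Rightarrow> complex poly" where
  "period_poly p m e \<beta> = (\<Prod>i<e. [:- gauss_period p m e \<beta> i, 1:])"

definition cyc_num :: "nat \<Rightarrow> nat \<Rightarrow> nat \<Rightarrow> 'K::{finite,field} \<Rightarrow> nat \<Rightarrow> nat \<Rightarrow> nat" where
  "cyc_num p m e \<beta> i j = card {(v1, v2). v1 < f_of p m e \<and> v2 < f_of p m e \<and>
       1 + \<beta> ^ (e * v1 + i) = \<beta> ^ (e * v2 + j)}"

definition D_ind :: "nat \<Rightarrow> nat \<Rightarrow> nat \<Rightarrow> 'K::{finite,field} \<Rightarrow> nat \<Rightarrow> int" where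
  "D_ind p m e \<beta> i = (if \<exists>x \<in> subfield_pm p m - {0}. - 1 = \<beta> ^ i * x ^ e then 1 else 0)"

definition mult_matrix :: "nat \<Rightarrow> nat \<Rightarrow> nat \<Rightarrow> 'K::{finite,field} \<Rightarrow> int mat" where
  "mult_matrix p m e \<beta> =
     mat e e (\<lambda>(i, j). int (cyc_num p m e \<beta> i j) - D_ind p m e \<beta> i * int (f_of p m e))"

definition d_comp :: "nat \<Rightarrow> int \<Rightarrow> 'a::comm_ring_1 mat \<Rightarrow> 'a mat \<Rightarrow> 'a mat" where
  "d_comp e d A B = mat e e (\<lambda>(i, j).
     (\<Sum>s<e. \<Sum>t<e. A $$ (s, t) *
        B $$ (nat ((d * int s + int i) mod int e), nat ((d * int t + int j) mod int e))))"

text \<open>n-fold (-1)-composition C * ... * C (n factors), for n >= 1.\<close>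
fun comp_power :: "nat \<Rightarrow> 'a::comm_ring_1 mat \<Rightarrow> nat \<Rightarrow> 'a mat" where
  "comp_power e A 0 = A"
| "comp_power e A (Suc 0) = A"
| "comp_power e A (Suc (Suc k)) = d_comp e (-1) A (comp_power e A (Suc k))"

end

theory Submission
  imports "HOL-Algebra.Algebraic_Closure_Type" "HOL-Number_Theory.Residues" Defs
begin

text \<open>
  For \<open>z\<close> with \<open>z\<^sup>e = 1\<close> the discrete Fourier transform \<open>G(z) = \<Sum>\<^sub>i z\<^sup>i \<eta>(i)\<close> of the periods is the
  Gauss sum of the character sending the generator to \<open>z\<close>. The relation
  \<open>\<eta>(a) \<eta>(a + i) = \<Sum>\<^sub>j C(i, j) \<eta>(a + j)\<close> becomes \<open>G(x) G(1/(xy)) = C'(x, y) G(1/y)\<close>, where \<open>C'\<close> is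
  the two-dimensional Fourier transform of the multiplication matrix. As \<open>G\<close> never vanishes, \<open>C'\<close>
  is determined by \<open>G\<close>. The Hasse-Davenport relation says that \<open>G\<close> for the extension of degree \<open>n\<close> is
  \<open>(-1)\<^bsup>n-1\<^esup> G\<^sup>n\<close>; hence its \<open>C'\<close> is \<open>(-1)\<^bsup>n-1\<^esup> C'\<^sup>n\<close>, and \<open>(-1)\<close>-composition is
  convolution on the Fourier side. The characteristic polynomial follows because the vectors
  \<open>(\<eta>(a + j))\<^sub>j\<close> form a basis of eigenvectors.
\<close>

section \<open>The Hasse-Davenport relation\<close>

text \<open>For \<open>N \<ge> 2\<close> the two monomials of X^N - X do not cancel, so this is a
  nonzero polynomial with at most \<open>N\<close> roots.\<close>

lemma card_power_eq_self_le:
  assumes "N \<ge> 2"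
  shows "finite {x::'a::idom. x ^ N = x} \<and> card {x::'a. x ^ N = x} \<le> N"
proof -
  define P where "P = (monom 1 N - monom 1 1 :: 'a poly)"
  have "coeff P N = 1" using assms by (simp add: P_def)
  hence P0: "P \<noteq> 0" by auto
  have "degree P \<le> N" unfolding P_def
    using assms by (intro degree_diff_le) (auto intro: order.trans[OF degree_monom_le])
  moreover have "{x::'a. x ^ N = x} = {x. poly P x = 0}" by (simp add: P_def poly_monom)
  ultimately show ?thesis
    using poly_roots_finite[OF P0] card_poly_roots_bound[OF P0] by simp
qed

text \<open>The polynomial splits into linear factors, and the multiset of their roots is
  \<open>proots f\<close>, in which each root is counted by its order.\<close>

lemma sum_order_eq_degree:
  fixes f :: "'a::alg_closed_field poly"
  assumes "f \<noteq> 0"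
  shows "(\<Sum>x | poly f x = 0. order x f) = degree f"
proof -
  obtain A where A: "size A = degree f" "f = smult (lead_coeff f) (\<Prod>x\<in>#A. [:-x, 1:])"
    using alg_closed_imp_factorization[OF assms] by blast
  have lc: "lead_coeff f \<noteq> 0" using assms by simp
  have "proots f = proots (\<Prod>x\<in>#A. [:-x, 1:])"
    using lc by (subst A(2)) (simp add: proots_smult)
  also have "\<dots> = A"
  proof (induction A)
    case (add x A)
    have "(\<Prod>x\<in>#A. [:- x, 1:]) \<noteq> 0" by (auto simp: prod_mset_zero_iff)
    hence "proots ([:-x, 1:] * (\<Prod>x\<in>#A. [:- x, 1:])) = {#x#} + proots (\<Prod>x\<in>#A. [:- x, 1:])"
      by (subst proots_mult) auto
    thus ?case using add by simp
  qed simp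
  finally have "size (proots f) = degree f" using A(1) by simp
  moreover have "size (proots f) = (\<Sum>x\<in>set_mset (proots f). count (proots f) x)"
    by (rule size_multiset_overloaded_eq)
  ultimately show ?thesis using assms by simp
qed

text \<open>Distinct linear factors are coprime: once those for \<open>B\<close> are divided out, a
  new root \<open>b\<close> keeps its full multiplicity in the cofactor.\<close>

lemma prod_linear_power_dvd:
  fixes f :: "'a::field poly"
  assumes "finite B" "f \<noteq> 0" "\<And>b. b \<in> B \<Longrightarrow> m \<le> order b f"
  shows "(\<Prod>b\<in>B. [:-b, 1:] ^ m) dvd f"
  using assms(1,3)
proof (induction B rule: finite_induct)
  case empty
  then show ?case by simp
next
  case (insert b B)
  let ?P = "\<Prod>b\<in>B. [:-b, 1:] ^ m"
  obtain g where g: "f = ?P * g" using insert by (auto elim!: dvdE)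
  have "poly ?P b \<noteq> 0" using insert(1,2) by (auto simp: poly_prod poly_power)
  hence "order b ?P = 0" by (rule order_0I)
  moreover have "order b f = order b ?P + order b g"
    using assms(2) unfolding g by (rule order_mult)
  ultimately have "m \<le> order b g" using insert.prems[of b] by simp
  hence "[:-b, 1:] ^ m dvd g" by (simp add: order_divides)
  thus ?case unfolding g using insert(1,2) by (simp add: mult_dvd_mono mult.commute)
qed

section \<open>Conjugates over the fixed field of a power map\<close>

text \<open>The fixed points of the \<open>q\<close>-power map play the role of the field with \<open>q\<close> elements.\<close>

locale power_endomorphism =
  fixes q :: nat and ty :: "'L::alg_closed_field itself"
  assumes q_ge_2: "q \<ge> 2"
    and power_q_add: "(x + y :: 'L) ^ q = x ^ q + y ^ q"
begin

definition frob :: "'L \<Rightarrow> 'L" where "frob x = x ^ q"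

sublocale frob: field_hom frob
  by unfold_locales (use q_ge_2 in \<open>auto simp: frob_def power_q_add power_mult_distrib\<close>)

sublocale frob_poly: map_poly_inj_idom_divide_hom frob ..

definition Fix :: "'L set" where "Fix = {x. x ^ q = x}"

definition monics :: "nat \<Rightarrow> 'L poly set" where
  "monics k = {f. degree f = k \<and> lead_coeff f = 1 \<and> (\<forall>i. coeff f i \<in> Fix)}"

text \<open>If \<open>x ^ (q ^ j) = x\<close>, this is the characteristic polynomial of
  \<open>x\<close> in the extension of degree \<open>j\<close> over \<open>Fix\<close>. It is a
  power of the minimal polynomial, since \<open>j\<close> may be a proper multiple of the degree of
  \<open>x\<close>.\<close>

definition conj_poly :: "nat \<Rightarrow> 'L \<Rightarrow> 'L poly" where
  "conj_poly j x = (\<Prod>i<j. [:- (x ^ (q ^ i)), 1:])"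

lemma monics_iff:
  "f \<in> monics k \<longleftrightarrow> degree f = k \<and> lead_coeff f = 1 \<and> map_poly frob f = f"
  by (auto simp: monics_def Fix_def frob_def poly_eq_iff)

lemma finite_Fix: "finite Fix"
  unfolding Fix_def using card_power_eq_self_le[OF q_ge_2] by blast

lemma finite_monics: "finite (monics k)"
proof (rule finite_subset)
  show "monics k \<subseteq> Poly ` {xs. set xs \<subseteq> Fix \<and> length xs \<le> Suc k}"
  proof
    fix f assume f: "f \<in> monics k"
    hence "set (coeffs f) \<subseteq> Fix" "length (coeffs f) \<le> Suc k"
      by (auto simp: monics_def coeffs_def)
    thus "f \<in> Poly ` {xs. set xs \<subseteq> Fix \<and> length xs \<le> Suc k}"
      by (intro image_eqI[of _ _ "coeffs f"]) auto
  qed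
  show "finite (Poly ` {xs. set xs \<subseteq> Fix \<and> length xs \<le> Suc k})"
    by (intro finite_imageI finite_lists_length_le finite_Fix)
qed

lemma power_q_power_add: "(x::'L) ^ (q ^ (a + b)) = (x ^ (q ^ a)) ^ (q ^ b)"
  by (simp add: power_add power_mult)

lemma degree_conj_poly: "degree (conj_poly j x) = j"
  unfolding conj_poly_def by (subst degree_prod_sum_eq) auto

text \<open>Applying \<open>frob\<close> moves each linear factor to the next one, and the last
  returns to the first because \<open>x ^ (q ^ j) = x\<close>.\<close>

lemma conj_poly_in_monics:
  assumes "x ^ (q ^ j) = x"
  shows "conj_poly j x \<in> monics j"
proof (cases j)
  case 0
  then show ?thesis by (simp add: monics_iff conj_poly_def)
next
  case (Suc m)
  let ?l = "\<lambda>i. [:- (x ^ (q ^ i)), 1:]"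
  have "map_poly frob (conj_poly j x) = (\<Prod>i<j. ?l (Suc i))"
    unfolding conj_poly_def frob_poly.hom_prod
    by (intro prod.cong refl)
      (simp add: frob_def[of "_ ^ _"] frob.hom_uminus power_q_power_add[of x _ 1, simplified])
  also have "\<dots> = (\<Prod>i<m. ?l (Suc i)) * ?l j" unfolding Suc by simp
  also have "?l j = ?l 0" using assms by simp
  also have "(\<Prod>i<m. ?l (Suc i)) * ?l 0 = conj_poly j x"
    unfolding conj_poly_def Suc prod.lessThan_Suc_shift by (simp add: mult.commute)
  finally have "map_poly frob (conj_poly j x) = conj_poly j x" .
  moreover have "lead_coeff (conj_poly j x) = 1" unfolding conj_poly_def lead_coeff_prod by simp
  ultimately show ?thesis unfolding monics_iff by (simp add: degree_conj_poly)
qed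

text \<open>Applying \<open>frob\<close> to \<open>f * g\<close> and cancelling \<open>f\<close>
  shows that the cofactor is fixed too. Dividing out a \<open>conj_poly\<close> therefore stays
  inside \<open>monics\<close>.\<close>

lemma monics_mult_iff:
  assumes "f \<in> monics j"
  shows "f * g \<in> monics (j + k) \<longleftrightarrow> g \<in> monics k"
proof -
  have f: "f \<noteq> 0" "lead_coeff f = 1" "degree f = j" "map_poly frob f = f"
    using assms by (auto simp: monics_iff)
  have *: "degree (f * g) = j + degree g" if "g \<noteq> 0" using f that by (simp add: degree_mult_eq)
  show ?thesis
    unfolding monics_iff lead_coeff_mult using f * by (cases "g = 0") (auto simp: frob_poly.hom_mult)
qed

text \<open>The homomorphism \<open>frob\<close> preserves orders of roots and fixes
  \<open>f\<close>.\<close>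

lemma order_root_conj:
  assumes "f \<in> monics k"
  shows "order (x ^ (q ^ i)) f = order x f"
proof (induction i)
  case (Suc i)
  have "order (frob (x ^ (q ^ i))) (map_poly frob f) = order (x ^ (q ^ i)) f"
    by (rule frob_poly.order_hom)
  thus ?case using Suc assms by (simp add: monics_iff frob_def flip: power_mult) (simp add: mult.commute)
qed auto

text \<open>If \<open>x\<close> has \<open>d\<close> conjugates, the admissible \<open>j\<close> are \<open>d, 2d, \<dots>, order x f * d\<close>.\<close>

lemma card_conj_poly_dvd:
  assumes f: "f \<in> monics k" and x: "poly f x = 0"
  shows "card {j \<in> {1..k}. x ^ (q ^ j) = x \<and> conj_poly j x dvd f} = order x f"
proof -
  have f0: "f \<noteq> 0" and degf: "degree f = k" using f by (auto simp: monics_iff)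
  have inj: "a = b" if "a ^ (q ^ i) = b ^ (q ^ i)" for a b :: 'L and i
    using that
  proof (induction i)
    case (Suc i)
    hence "frob (a ^ (q ^ i)) = frob (b ^ (q ^ i))" by (simp add: frob_def mult.commute flip: power_mult)
    thus ?case using Suc by simp
  qed auto
  \<comment> \<open>All conjugates lie among the finitely many roots of \<open>f\<close>, so two of
    them coincide; injectivity then cancels the smaller exponent.\<close>
  have "\<exists>i\<ge>1. x ^ (q ^ i) = x"
  proof -
    have "x ^ (q ^ i) \<in> {y. poly f y = 0}" for i
      using order_root_conj[OF f, of x i] f0 x by (simp add: order_root)
    hence "finite (range (\<lambda>i. x ^ (q ^ i)))"
      using poly_roots_finite[OF f0] by (meson finite_subset image_subsetI)
    hence "\<not> inj (\<lambda>i. x ^ (q ^ i))" using finite_imageD infinite_UNIV_nat by blast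
    then obtain a b where "a < b" "x ^ (q ^ a) = x ^ (q ^ b)"
      unfolding inj_def by (metis linorder_neqE_nat)
    moreover from this have "x ^ (q ^ b) = (x ^ (q ^ (b - a))) ^ (q ^ a)"
      by (simp flip: power_q_power_add)
    ultimately have "x ^ (q ^ (b - a)) = x" using inj[of x a "x ^ (q ^ (b - a))"] by simp
    thus ?thesis using \<open>a < b\<close> by (intro exI[of _ "b - a"]) auto
  qed
  hence ex: "\<exists>i. i \<ge> 1 \<and> x ^ (q ^ i) = x" .
  define d where "d = (LEAST i. i \<ge> 1 \<and> x ^ (q ^ i) = x)"
  have d: "d \<ge> 1" "x ^ (q ^ d) = x" using LeastI_ex[OF ex] by (auto simp: d_def)
  have dmin: "i = 0" if "i < d" "x ^ (q ^ i) = x" for i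
    using not_less_Least[of i "\<lambda>i. i \<ge> 1 \<and> x ^ (q ^ i) = x"] that by (auto simp: d_def)
  have dmult: "x ^ (q ^ (d * m)) = x" for m
    by (induction m) (use d in \<open>simp_all add: power_q_power_add\<close>)
  have iff: "x ^ (q ^ j) = x \<longleftrightarrow> d dvd j" for j
  proof
    assume "x ^ (q ^ j) = x"
    moreover have "x ^ (q ^ j) = x ^ (q ^ (j mod d))"
      using power_q_power_add[of x "d * (j div d)" "j mod d"] dmult by simp
    ultimately show "d dvd j" using dmin[of "j mod d"] d by (simp add: mod_eq_0_iff_dvd)
  qed (use dmult in auto)
  have inj_on: "inj_on (\<lambda>i. x ^ (q ^ i)) {..<d}"
  proof (rule linorder_inj_onI')
    fix a b assume ab: "a \<in> {..<d}" "b \<in> {..<d}" "a < b"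
    show "x ^ (q ^ a) \<noteq> x ^ (q ^ b)"
    proof
      assume "x ^ (q ^ a) = x ^ (q ^ b)"
      moreover have "x ^ (q ^ b) = (x ^ (q ^ (b - a))) ^ (q ^ a)"
        using ab by (simp flip: power_q_power_add)
      ultimately have "x ^ (q ^ (b - a)) = x" using inj[of x a "x ^ (q ^ (b - a))"] by simp
      moreover have "b - a < d" using ab by simp
      ultimately show False using dmin[of "b - a"] ab by simp
    qed
  qed
  \<comment> \<open>Past index \<open>d\<close> the conjugates repeat, so \<open>m\<close> rounds
    give an \<open>m\<close>-th power.\<close>
  have pow: "conj_poly (d * m) x = conj_poly d x ^ m" for m
  proof (induction m)
    case (Suc m)
    have "conj_poly (d * Suc m) x = (\<Prod>i<d * m + d. [:- (x ^ (q ^ i)), 1:])"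
      by (simp add: conj_poly_def add.commute)
    also have "\<dots> = conj_poly (d * m) x * (\<Prod>i<d. [:- (x ^ (q ^ (d * m + i))), 1:])"
      unfolding conj_poly_def by (simp add: lessThan_atLeast0 prod.atLeastLessThan_concat[of 0 "d * m" "d * m + d", symmetric]
          prod.atLeastLessThan_shift_0[of _ "d * m"])
    also have "(\<Prod>i<d. [:- (x ^ (q ^ (d * m + i))), 1:]) = conj_poly d x"
      unfolding conj_poly_def power_q_power_add dmult ..
    finally show ?case using Suc by (simp add: mult.commute)
  qed (simp add: conj_poly_def)
  \<comment> \<open>The factor at \<open>x\<close> alone bounds \<open>m\<close>. Conversely all
    \<open>d\<close> distinct conjugates have the same order in \<open>f\<close>, so the
    \<open>m\<close>-th powers of their linear factors divide \<open>f\<close> jointly.\<close>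
  have dvd_iff: "conj_poly (d * m) x dvd f \<longleftrightarrow> m \<le> order x f" for m
  proof
    assume "conj_poly (d * m) x dvd f"
    moreover have "[:-x, 1:] dvd conj_poly d x"
      unfolding conj_poly_def using d by (intro dvd_prod_eqI[of _ 0]) auto
    ultimately have "[:-x, 1:] ^ m dvd f"
      unfolding pow by (meson dvd_power_same dvd_trans)
    thus "m \<le> order x f" using f0 by (simp add: order_divides)
  next
    assume m: "m \<le> order x f"
    have "conj_poly (d * m) x = (\<Prod>b\<in>(\<lambda>i. x ^ (q ^ i)) ` {..<d}. [:-b, 1:] ^ m)"
      unfolding pow unfolding conj_poly_def prod_power_distrib[symmetric]
      by (subst prod.reindex[OF inj_on]) simp
    also have "\<dots> dvd f"
      by (rule prod_linear_power_dvd) (use f0 m order_root_conj[OF f] in auto)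
    finally show "conj_poly (d * m) x dvd f" .
  qed
  have "{j \<in> {1..k}. x ^ (q ^ j) = x \<and> conj_poly j x dvd f} = (\<lambda>m. d * m) ` {1..order x f}"
  proof (intro Set.set_eqI iffI)
    fix j assume "j \<in> {j \<in> {1..k}. x ^ (q ^ j) = x \<and> conj_poly j x dvd f}"
    then obtain m where "j = d * m" "j \<ge> 1" "conj_poly j x dvd f" using iff by auto
    moreover from this have "m \<ge> 1" by (cases m) auto
    ultimately show "j \<in> (\<lambda>m. d * m) ` {1..order x f}" using dvd_iff[of m] by auto
  next
    fix j assume "j \<in> (\<lambda>m. d * m) ` {1..order x f}"
    then obtain m where "j = d * m" "m \<in> {1..order x f}" by (rule imageE)
    hence m: "j = d * m" "m \<ge> 1" "m \<le> order x f" by auto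
    have "conj_poly j x dvd f" using m dvd_iff by simp
    moreover from dvd_imp_degree_le[OF this f0] have "j \<le> k" by (simp add: degree_conj_poly degf)
    ultimately show "j \<in> {j \<in> {1..k}. x ^ (q ^ j) = x \<and> conj_poly j x dvd f}"
      using m d dmult by auto
  qed
  also have "card \<dots> = order x f" using d by (subst card_image) (auto simp: inj_on_def)
  finally show ?thesis .
qed

end

section \<open>Character sums over monic polynomials and their L-series\<close>

locale hasse_davenport = power_endomorphism q ty
  for q :: nat and ty :: "'L::alg_closed_field itself" +
  fixes \<chi> \<psi> :: "'L \<Rightarrow> complex"
  assumes chi_mult: "x \<in> Fix \<Longrightarrow> y \<in> Fix \<Longrightarrow> \<chi> (x * y) = \<chi> x * \<chi> y"
    and chi_1: "\<chi> 1 = 1"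
    and psi_add: "x \<in> Fix \<Longrightarrow> y \<in> Fix \<Longrightarrow> \<psi> (x + y) = \<psi> x * \<psi> y"
    and psi_0: "\<psi> 0 = 1"
    and psi_nontrivial: "\<exists>c \<in> Fix. \<psi> c \<noteq> 1"
begin

text \<open>For a monic \<open>f\<close> this is \<open>\<chi>\<close> of the product of the roots times \<open>\<psi>\<close> of their sum;
  reading the second highest coefficient off the reversed polynomial also covers degree 0.\<close>

definition poly_char :: "'L poly \<Rightarrow> complex" where
  "poly_char f = \<chi> ((-1) ^ degree f * coeff f 0) * \<psi> (- coeff (reflect_poly f) 1)"

definition poly_char_sum :: "nat \<Rightarrow> complex" where
  "poly_char_sum k = (\<Sum>f\<in>monics k. poly_char f)"

text \<open>The Gauss sum over the extension of degree \<open>j\<close> for the characters composed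
  with norm and trace; \<open>poly_char_conj_poly\<close> makes this explicit.\<close>

definition lifted_gauss_sum :: "nat \<Rightarrow> complex" where
  "lifted_gauss_sum j = (\<Sum>x | x ^ (q ^ j) = x. poly_char (conj_poly j x))"

lemma Fix_closed:
  "x \<in> Fix \<Longrightarrow> y \<in> Fix \<Longrightarrow> x + y \<in> Fix" "x \<in> Fix \<Longrightarrow> y \<in> Fix \<Longrightarrow> x * y \<in> Fix"
  "x \<in> Fix \<Longrightarrow> - x \<in> Fix" "(0::'L) \<in> Fix" "(1::'L) \<in> Fix" "x \<in> Fix \<Longrightarrow> x ^ k \<in> Fix"
  using frob.hom_add[of x y] frob.hom_mult[of x y] frob.hom_uminus[of x] frob.hom_zero frob.hom_one
    frob.hom_power[of x k]
  by (auto simp: Fix_def frob_def)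

lemma poly_char_1: "poly_char 1 = 1"
  by (simp add: poly_char_def chi_1 psi_0)

text \<open>For monic polynomials the products of the roots multiply and the sums of the roots add.
  The latter is read off from the reversed polynomials, which multiply and have constant term
  1.\<close>

lemma poly_char_mult:
  assumes "f \<in> monics j" "g \<in> monics k"
  shows "poly_char (f * g) = poly_char f * poly_char g"
proof -
  have fg: "f \<noteq> 0" "g \<noteq> 0" "lead_coeff f = 1" "lead_coeff g = 1"
    "\<And>i. coeff f i \<in> Fix" "\<And>i. coeff g i \<in> Fix"
    using assms by (auto simp: monics_def)
  have r: "coeff (reflect_poly h) i \<in> Fix" if "\<And>i. coeff h i \<in> Fix" for h i
    using that by (simp add: coeff_reflect_poly Fix_closed)
  have "(-1) ^ degree (f * g) * coeff (f * g) 0 =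
      ((-1) ^ degree f * coeff f 0) * ((-1) ^ degree g * coeff g 0)"
    using fg by (simp add: degree_mult_eq power_add coeff_mult)
  moreover have "- coeff (reflect_poly (f * g)) 1 = - coeff (reflect_poly f) 1 + - coeff (reflect_poly g) 1"
    using fg by (simp add: reflect_poly_mult coeff_mult coeff_reflect_poly[of _ 0])
  moreover have "\<psi> (- coeff (reflect_poly f) 1 + - coeff (reflect_poly g) 1) =
      \<psi> (- coeff (reflect_poly f) 1) * \<psi> (- coeff (reflect_poly g) 1)"
    using fg by (intro psi_add Fix_closed r)
  moreover have "\<chi> (((-1) ^ degree f * coeff f 0) * ((-1) ^ degree g * coeff g 0)) =
      \<chi> ((-1) ^ degree f * coeff f 0) * \<chi> ((-1) ^ degree g * coeff g 0)"
    using fg by (intro chi_mult Fix_closed)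
  ultimately show ?thesis unfolding poly_char_def by (simp only: mult_ac)
qed

text \<open>Vieta: the two coefficients seen by \<open>poly_char\<close> are, up to sign, the norm
  and the trace of \<open>x\<close>.\<close>

lemma poly_char_conj_poly:
  "poly_char (conj_poly j x) = \<chi> (\<Prod>i<j. x ^ (q ^ i)) * \<psi> (\<Sum>i<j. x ^ (q ^ i))"
proof -
  have "coeff (conj_poly j x) 0 = (\<Prod>i<j. - (x ^ (q ^ i)))"
    by (simp add: conj_poly_def poly_prod flip: poly_0_coeff_0)
  also have "\<dots> = (-1) ^ j * (\<Prod>i<j. x ^ (q ^ i))"
    by (induction j) (auto simp: algebra_simps)
  finally have c0: "coeff (conj_poly j x) 0 = (-1) ^ j * (\<Prod>i<j. x ^ (q ^ i))" .
  have "coeff (reflect_poly (conj_poly j x)) 0 = 1 \<and>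
      coeff (reflect_poly (conj_poly j x)) 1 = - (\<Sum>i<j. x ^ (q ^ i))"
  proof (induction j)
    case (Suc j)
    have "reflect_poly (conj_poly (Suc j) x) = reflect_poly (conj_poly j x) * [:1, - (x ^ (q ^ j)):]"
      by (simp add: conj_poly_def reflect_poly_mult reflect_poly_def[of "[:_, _:]"] del: mult_pCons_right)
    thus ?case using Suc by (simp add: coeff_mult)
  qed (simp add: conj_poly_def)
  with c0 show ?thesis
    by (simp add: poly_char_def degree_conj_poly flip: mult.assoc power_add)
qed

lemma poly_char_sum_0: "poly_char_sum 0 = 1"
proof -
  have "monics 0 = {1}"
    by (auto simp: monics_def Fix_closed elim!: degree_eq_zeroE)
  thus ?thesis by (simp add: poly_char_sum_def poly_char_1)
qed

lemma poly_char_sum_1: "poly_char_sum 1 = (\<Sum>x\<in>Fix. \<chi> x * \<psi> x)"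
proof -
  have "monics 1 = (\<lambda>x. [:-x, 1:]) ` Fix"
  proof (intro Set.set_eqI iffI)
    fix f assume "f \<in> monics 1"
    hence f: "degree f = 1" "coeff f 1 = 1" "coeff f 0 \<in> Fix" by (auto simp: monics_def)
    hence "f = [:- (- coeff f 0), 1:]"
      by (intro poly_eqI) (auto simp: coeff_pCons coeff_eq_0 split: nat.splits)
    thus "f \<in> (\<lambda>x. [:-x, 1:]) ` Fix" using Fix_closed(3)[OF f(3)] by blast
  qed (auto simp: monics_def Fix_closed coeff_pCons split: nat.splits)
  moreover have "inj_on (\<lambda>x. [:-x, 1:]) Fix" by (auto simp: inj_on_def)
  moreover have "poly_char [:-x, 1:] = \<chi> x * \<psi> x" for x
    using poly_char_conj_poly[of 1 x] by (simp add: conj_poly_def)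
  ultimately show ?thesis by (simp add: poly_char_sum_def sum.reindex)
qed

text \<open>Translating the second highest coefficient by \<open>c\<close> multiplies the sum by \<open>\<psi> (-c)\<close>.\<close>

lemma poly_char_sum_eq_0:
  assumes "k \<ge> 2"
  shows "poly_char_sum k = 0"
proof -
  obtain c where c: "c \<in> Fix" "\<psi> c \<noteq> 1" using psi_nontrivial by blast
  let ?t = "\<lambda>c f. f + monom c (k - 1)"
  have t: "?t c f \<in> monics k" if "f \<in> monics k" "c \<in> Fix" for c f
  proof -
    have "degree (monom c (k - 1)) < degree f"
      using that assms degree_monom_le[of c "k - 1"] by (auto simp: monics_def)
    hence "degree (?t c f) = degree f" by (rule degree_add_eq_left)
    thus ?thesis using that assms by (auto simp: monics_def Fix_closed)
  qed
  have "poly_char_sum k = (\<Sum>f\<in>monics k. poly_char (?t (-c) f))"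
    unfolding poly_char_sum_def
  proof (rule sum.reindex_bij_witness[of _ "?t (-c)" "?t c"])
    have inv: "?t (-a) (?t a f) = f" for a :: 'L and f by (simp add: add.assoc add_monom)
    show "?t (-c) (?t c f) = f" for f by (rule inv)
    show "?t c (?t (-c) f) = f" for f by (simp add: add.assoc add_monom)
    show "poly_char (?t (-c) (?t c f)) = poly_char f" for f unfolding inv ..
    show "?t c f \<in> monics k" "?t (-c) f \<in> monics k" if "f \<in> monics k" for f
      using t[OF that c(1)] t[OF that Fix_closed(3)[OF c(1)]] .
  qed
  also have "\<dots> = (\<Sum>f\<in>monics k. \<psi> c * poly_char f)"
  proof (rule sum.cong[OF refl])
    fix f assume f: "f \<in> monics k"
    have "?t (-c) f \<in> monics k" by (rule t[OF f Fix_closed(3)[OF c(1)]])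
    hence "degree (?t (-c) f) = k" "degree f = k" using f by (auto simp: monics_def)
    moreover have "coeff f (k - 1) \<in> Fix" using f by (simp add: monics_def)
    \<comment> \<open>As \<open>k \<ge> 2\<close>, the coefficient at \<open>k - 1\<close> is not
      the constant term, so the argument of \<chi> is untouched.\<close>
    ultimately show "poly_char (?t (-c) f) = \<psi> c * poly_char f"
      using assms psi_add[OF _ c(1), of "- coeff f (k - 1)"]
      by (simp add: poly_char_def coeff_reflect_poly Fix_closed)
  qed
  also have "\<dots> = \<psi> c * poly_char_sum k" by (simp add: poly_char_sum_def sum_distrib_left)
  finally have "\<psi> c * poly_char_sum k = poly_char_sum k" ..
  thus ?thesis using c by simp
qed

lemma finite_power_q_power_eq_self:
  assumes "j \<ge> 1" shows "finite {x::'L. x ^ (q ^ j) = x}"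
proof -
  have "q ^ 1 \<le> q ^ j" using q_ge_2 assms by (intro power_increasing) auto
  hence "2 \<le> q ^ j" using q_ge_2 by simp
  from card_power_eq_self_le[OF this] show ?thesis by blast
qed

text \<open>Double counting of the pairs \<open>(j, x)\<close>: each root \<open>x\<close> of
  \<open>f\<close> admits exactly \<open>order x f\<close> values of \<open>j\<close>, and the
  orders add up to the degree.\<close>

lemma card_conj_divisors:
  assumes "f \<in> monics k"
  shows "(\<Sum>j=1..k. card {x. x ^ (q ^ j) = x \<and> conj_poly j x dvd f}) = k"
proof -
  have f0: "f \<noteq> 0" and deg: "degree f = k" using assms by (auto simp: monics_iff)
  let ?R = "{x. poly f x = 0}"
  let ?P = "\<lambda>j x. x ^ (q ^ j) = x \<and> conj_poly j x dvd f"
  have fin: "finite ?R" by (rule poly_roots_finite[OF f0])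
  have root: "poly f x = 0" if "j \<in> {1..k}" "conj_poly j x dvd f" for j x
  proof -
    have "[:-x, 1:] dvd conj_poly j x"
      unfolding conj_poly_def using that by (intro dvd_prod_eqI[of _ 0]) auto
    thus ?thesis using that by (meson dvd_trans poly_eq_0_iff_dvd)
  qed
  have "(\<Sum>j=1..k. card {x. ?P j x}) = (\<Sum>j=1..k. \<Sum>x\<in>?R. if ?P j x then 1 else 0)"
  proof (rule sum.cong[OF refl])
    fix j assume "j \<in> {1..k}"
    hence "{x. ?P j x} = {x \<in> ?R. ?P j x}" using root by blast
    thus "card {x. ?P j x} = (\<Sum>x\<in>?R. if ?P j x then 1 else 0)"
      using fin by (simp only: sum.inter_filter[symmetric] card_eq_sum)
  qed
  also have "\<dots> = (\<Sum>x\<in>?R. \<Sum>j=1..k. if ?P j x then 1 else 0)" by (rule sum.swap)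
  also have "\<dots> = (\<Sum>x\<in>?R. order x f)"
  proof (rule sum.cong[OF refl])
    fix x assume "x \<in> ?R"
    hence "order x f = card {j \<in> {1..k}. ?P j x}" using card_conj_poly_dvd[OF assms] by simp
    also have "\<dots> = (\<Sum>j=1..k. if ?P j x then 1 else 0)"
      by (subst sum.inter_filter[symmetric]) auto
    finally show "(\<Sum>j=1..k. if ?P j x then 1 else 0) = order x f" ..
  qed
  also have "\<dots> = k" using sum_order_eq_degree[OF f0] deg by simp
  finally show ?thesis .
qed

text \<open>The coefficientwise form of the logarithmic derivative of the \<open>L\<close>-series
  \<open>\<Sum>\<^sub>k poly_char_sum k T\<^sup>k\<close>.\<close>

lemma poly_char_sum_recurrence:
  "of_nat k * poly_char_sum k = (\<Sum>j=1..k. lifted_gauss_sum j * poly_char_sum (k - j))"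
proof -
  \<comment> \<open>The product is a sum over pairs of an \<open>x\<close> and a monic
    \<open>g\<close>; these are regrouped by the polynomial \<open>f = conj_poly j x * g\<close> of
    degree \<open>k\<close>.\<close>
  have "lifted_gauss_sum j * poly_char_sum (k - j) =
      (\<Sum>f\<in>monics k. of_nat (card {x. x ^ (q ^ j) = x \<and> conj_poly j x dvd f}) * poly_char f)"
    if j: "j \<in> {1..k}" for j
  proof -
    let ?R = "{x::'L. x ^ (q ^ j) = x}"
    have fin: "finite ?R" using finite_power_q_power_eq_self j by simp
    have "(\<Sum>g\<in>monics (k - j). poly_char (conj_poly j x) * poly_char g) =
        (\<Sum>f\<in>monics k. if conj_poly j x dvd f then poly_char f else 0)" if "x \<in> ?R" for x
    proof -
      have c: "conj_poly j x \<in> monics j" using that by (simp add: conj_poly_in_monics)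
      hence c0: "conj_poly j x \<noteq> 0" by (auto simp: monics_iff)
      have "(\<Sum>f\<in>monics k. if conj_poly j x dvd f then poly_char f else 0) =
          (\<Sum>f\<in>{f \<in> monics k. conj_poly j x dvd f}. poly_char f)"
        by (simp add: sum.inter_filter finite_monics)
      also have "\<dots> = (\<Sum>g\<in>monics (k - j). poly_char (conj_poly j x * g))"
      proof -
        have iff: "conj_poly j x * g \<in> monics k \<longleftrightarrow> g \<in> monics (k - j)" for g
          using monics_mult_iff[OF c, of g "k - j"] j by simp
        have "{f \<in> monics k. conj_poly j x dvd f} = (\<lambda>g. conj_poly j x * g) ` monics (k - j)"
          using iff by (force elim!: dvdE)
        moreover have "inj_on (\<lambda>g. conj_poly j x * g) (monics (k - j))"
          using c0 by (simp add: inj_on_def)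
        ultimately show ?thesis by (simp add: sum.reindex)
      qed
      also have "\<dots> = (\<Sum>g\<in>monics (k - j). poly_char (conj_poly j x) * poly_char g)"
        using c by (intro sum.cong) (auto simp: poly_char_mult)
      finally show ?thesis ..
    qed
    hence "lifted_gauss_sum j * poly_char_sum (k - j) =
        (\<Sum>x\<in>?R. \<Sum>f\<in>monics k. if conj_poly j x dvd f then poly_char f else 0)"
      unfolding lifted_gauss_sum_def poly_char_sum_def sum_product by simp
    also have "\<dots> = (\<Sum>f\<in>monics k. \<Sum>x\<in>?R. if conj_poly j x dvd f then poly_char f else 0)"
      by (rule sum.swap)
    also have "\<dots> = (\<Sum>f\<in>monics k. of_nat (card {x. x ^ (q ^ j) = x \<and> conj_poly j x dvd f}) * poly_char f)"
      using fin by (intro sum.cong refl) (simp add: sum.inter_filter[symmetric])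
    finally show ?thesis .
  qed
  hence "(\<Sum>j=1..k. lifted_gauss_sum j * poly_char_sum (k - j)) = (\<Sum>j=1..k. \<Sum>f\<in>monics k.
      of_nat (card {x. x ^ (q ^ j) = x \<and> conj_poly j x dvd f}) * poly_char f)"
    by (rule sum.cong[OF refl])
  also have "\<dots> = (\<Sum>f\<in>monics k.
      (\<Sum>j=1..k. of_nat (card {x. x ^ (q ^ j) = x \<and> conj_poly j x dvd f})) * poly_char f)"
    unfolding sum_distrib_right by (rule sum.swap)
  also have "\<dots> = (\<Sum>f\<in>monics k. of_nat k * poly_char f)"
    by (intro sum.cong refl) (simp only: card_conj_divisors flip: of_nat_sum)
  finally show ?thesis by (simp add: poly_char_sum_def sum_distrib_left)
qed

text \<open>The L-series is 1 + GT with G the Gauss sum over \<open>Fix\<close>. From degree 2 on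
  the left side of the recurrence vanishes and only two terms survive on the right, so each lifted
  sum is -G times the previous one.\<close>

lemma lifted_gauss_sum_Suc:
  "lifted_gauss_sum (Suc m) = (-1) ^ m * (\<Sum>x\<in>Fix. \<chi> x * \<psi> x) ^ Suc m"
proof (induction m)
  case 0
  show ?case using poly_char_sum_recurrence[of 1] by (simp add: poly_char_sum_0 poly_char_sum_1[simplified])
next
  case (Suc m)
  have "0 = (\<Sum>j=1..Suc (Suc m). lifted_gauss_sum j * poly_char_sum (Suc (Suc m) - j))"
    using poly_char_sum_recurrence[of "Suc (Suc m)"] by (simp add: poly_char_sum_eq_0)
  also have "\<dots> = (\<Sum>j\<in>{Suc m, Suc (Suc m)}. lifted_gauss_sum j * poly_char_sum (Suc (Suc m) - j))"
    by (rule sum.mono_neutral_right) (auto intro!: poly_char_sum_eq_0)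
  also have "\<dots> = lifted_gauss_sum (Suc m) * (\<Sum>x\<in>Fix. \<chi> x * \<psi> x) + lifted_gauss_sum (Suc (Suc m))"
    by (simp add: poly_char_sum_0 poly_char_sum_1[simplified])
  finally show ?case using Suc by (simp add: eq_neg_iff_add_eq_0 algebra_simps)
qed

theorem hasse_davenport:
  assumes "n \<ge> 1"
  shows "(\<Sum>x | x ^ (q ^ n) = x. \<chi> (\<Prod>i<n. x ^ (q ^ i)) * \<psi> (\<Sum>i<n. x ^ (q ^ i))) =
    (-1) ^ (n - 1) * (\<Sum>x\<in>Fix. \<chi> x * \<psi> x) ^ n"
  using lifted_gauss_sum_Suc[of "n - 1"] assms
  by (simp add: lifted_gauss_sum_def poly_char_conj_poly)

end

section \<open>Fourier transform on roots of unity\<close>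

text \<open>The summand \<open>x ^ i * h i\<close> has period \<open>e\<close>, so any full period
  gives the same sum. One shift compares the two ways of splitting off an end term from a sum over
  \<open>Suc e\<close> indices.\<close>

lemma sum_power_shift:
  fixes x :: "'a::comm_ring_1"
  assumes "\<And>i. h (i + e) = h i" "x ^ e = 1"
  shows "x ^ m * (\<Sum>i<e. x ^ i * h (i + m)) = (\<Sum>i<e. x ^ i * h i)"
proof (induction m)
  case (Suc m)
  have "(\<Sum>i<Suc e. x ^ i * h (i + m)) = h m + (\<Sum>i<e. x ^ Suc i * h (Suc i + m))"
    unfolding sum.lessThan_Suc_shift by simp
  moreover have "(\<Sum>i<Suc e. x ^ i * h (i + m)) = (\<Sum>i<e. x ^ i * h (i + m)) + h m"
    using assms(1)[of m] assms(2) by (simp add: add.commute)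
  ultimately have "(\<Sum>i<e. x ^ i * h (i + m)) = x * (\<Sum>i<e. x ^ i * h (i + Suc m))"
    by (simp add: sum_distrib_left mult.assoc)
  thus ?case using Suc by (simp add: mult_ac)
qed simp

lemma sum_periodic_shift:
  fixes h :: "nat \<Rightarrow> 'a::comm_ring_1"
  assumes "\<And>i. h (i + e) = h i"
  shows "(\<Sum>i<e. h (i + m)) = (\<Sum>i<e. h i)"
  using sum_power_shift[of h e 1 m] assms by simp

lemma periodic_mod:
  fixes h :: "nat \<Rightarrow> 'a"
  assumes "\<And>i. h (i + e) = h i"
  shows "h (i mod e) = h i"
proof -
  have "h (i mod e + e * k) = h (i mod e)" for k
  proof (induction k)
    case (Suc k)
    have "h (i mod e + e * Suc k) = h (i mod e + e * k + e)" by (simp add: algebra_simps)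
    thus ?case using Suc assms by simp
  qed simp
  from this[of "i div e"] show ?thesis by simp
qed

text \<open>The polynomial with coefficients \<open>c\<close> has degree below \<open>e\<close> but
  vanishes at all \<open>e\<close> roots of unity.\<close>

lemma dft_eq_0_imp:
  fixes c :: "nat \<Rightarrow> complex"
  assumes "\<And>z. z ^ e = 1 \<Longrightarrow> (\<Sum>i<e. c i * z ^ i) = 0" "i < e"
  shows "c i = 0"
proof -
  define P where "P = (\<Sum>i<e. monom (c i) i)"
  have coeff: "coeff P i = (if i < e then c i else 0)" for i
    unfolding P_def coeff_sum by (simp add: if_distrib cong: if_cong)
  have "P = 0"
  proof (rule ccontr)
    assume P: "P \<noteq> 0"
    have "{z. z ^ e = 1} \<subseteq> {z. poly P z = 0}"
      using assms(1) by (auto simp: P_def poly_sum poly_monom)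
    hence "card {z::complex. z ^ e = 1} \<le> card {z. poly P z = 0}"
      using poly_roots_finite[OF P] by (intro card_mono)
    moreover have "card {z. poly P z = 0} \<le> degree P" using P by (rule card_poly_roots_bound)
    moreover have "degree P < e"
      using P coeff[of "degree P"] leading_coeff_0_iff[of P] by (auto split: if_splits)
    ultimately show False using card_roots_unity_eq[of e] assms(2) by simp
  qed
  thus ?thesis using coeff[of i] assms(2) by simp
qed

definition dft2 :: "nat \<Rightarrow> int mat \<Rightarrow> complex \<Rightarrow> complex \<Rightarrow> complex" where
  "dft2 e A x y = (\<Sum>i<e. \<Sum>j<e. of_int (A $$ (i, j)) * x ^ i * y ^ j)"

text \<open>One-dimensional Fourier inversion is applied twice, first to the row index and then to
  the column index.\<close>

lemma mat_eqI_dft2: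
  assumes "A \<in> carrier_mat e e" "B \<in> carrier_mat e e"
    and "\<And>x y. x ^ e = 1 \<Longrightarrow> y ^ e = 1 \<Longrightarrow> dft2 e A x y = dft2 e B x y"
  shows "A = B"
proof (rule eq_matI)
  fix i j assume "i < dim_row B" "j < dim_col B"
  hence ij: "i < e" "j < e" using assms by auto
  have "(\<Sum>j<e. of_int (A $$ (i, j) - B $$ (i, j)) * y ^ j) = 0" if "y ^ e = 1" for y :: complex
  proof (rule dft_eq_0_imp[OF _ ij(1)])
    fix x :: complex assume "x ^ e = 1"
    have "(\<Sum>i<e. (\<Sum>j<e. of_int (A $$ (i, j) - B $$ (i, j)) * y ^ j) * x ^ i) =
        dft2 e A x y - dft2 e B x y"
      by (simp add: dft2_def sum_distrib_right sum_distrib_left algebra_simps sum_subtractf)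
    thus "(\<Sum>i<e. (\<Sum>j<e. of_int (A $$ (i, j) - B $$ (i, j)) * y ^ j) * x ^ i) = 0"
      using assms(3) \<open>x ^ e = 1\<close> that by simp
  qed
  from dft_eq_0_imp[OF this ij(2)] have "of_int (A $$ (i, j) - B $$ (i, j)) = (0::complex)" .
  thus "A $$ (i, j) = B $$ (i, j)" by simp
qed (use assms in auto)

text \<open>Modulo \<open>e\<close>, going back by \<open>s\<close> is going forward by
  \<open>e - s\<close>, which stays in the natural numbers; \<open>x ^ e = 1\<close> turns the
  resulting factor into \<open>x ^ s\<close>.\<close>

lemma sum_power_shift_neg:
  fixes x :: "'a::comm_ring_1"
  assumes "x ^ e = 1" "s < e"
  shows "(\<Sum>i<e. x ^ i * h (nat ((- 1 * int s + int i) mod int e))) = x ^ s * (\<Sum>i<e. x ^ i * h i)"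
proof -
  have "nat ((- 1 * int s + int i) mod int e) = (i + (e - s)) mod e" for i
  proof -
    have "(- 1 * int s + int i) mod int e = (- 1 * int s + int i + int e) mod int e" by simp
    also have "\<dots> = int ((i + (e - s)) mod e)"
      using assms(2) by (simp add: zmod_int algebra_simps of_nat_diff)
    finally show ?thesis by simp
  qed
  hence "(\<Sum>i<e. x ^ i * h (nat ((- 1 * int s + int i) mod int e))) =
      x ^ s * (x ^ (e - s) * (\<Sum>i<e. x ^ i * h ((i + (e - s)) mod e)))"
    using assms by (simp flip: power_add mult.assoc)
  also have "\<dots> = x ^ s * (\<Sum>i<e. x ^ i * h (i mod e))"
    using assms by (subst sum_power_shift[where h = "\<lambda>i. h (i mod e)"]) auto
  finally show ?thesis by simp
qed

text \<open>For d = -1 the composition is cyclic convolution in both indices: shifting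
  \<open>B\<close> by (s, t) multiplies its transform by \<open>x ^ s * y ^ t\<close>.\<close>

lemma dft2_d_comp:
  assumes "x ^ e = 1" "y ^ e = 1"
  shows "dft2 e (d_comp e (-1) A B) x y = dft2 e A x y * dft2 e B x y"
proof -
  define \<sigma> where "\<sigma> s i = nat ((- 1 * int s + int i) mod int e)" for s i
  have shift: "(\<Sum>i<e. x ^ i * h (\<sigma> s i)) = x ^ s * (\<Sum>i<e. x ^ i * h i)"
    if "s < e" "x ^ e = 1" for x :: complex and s h
    unfolding \<sigma>_def using that by (rule sum_power_shift_neg[rotated])
  have "dft2 e (d_comp e (-1) A B) x y =
      (\<Sum>i<e. \<Sum>j<e. \<Sum>s<e. \<Sum>t<e. of_int (A $$ (s, t)) * (x ^ i * (y ^ j * of_int (B $$ (\<sigma> s i, \<sigma> t j)))))"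
    by (simp add: dft2_def d_comp_def \<sigma>_def sum_distrib_left sum_distrib_right mult_ac)
  also have "\<dots> = (\<Sum>s<e. \<Sum>t<e. \<Sum>i<e. \<Sum>j<e. of_int (A $$ (s, t)) * (x ^ i * (y ^ j * of_int (B $$ (\<sigma> s i, \<sigma> t j)))))"
  proof -
    have swap: "(\<Sum>j<e. \<Sum>s<e. \<Sum>t<e. g j s t) = (\<Sum>s<e. \<Sum>t<e. \<Sum>j<e. g j s t)"
      for g :: "nat \<Rightarrow> nat \<Rightarrow> nat \<Rightarrow> complex"
    proof -
      have "(\<Sum>j<e. \<Sum>s<e. \<Sum>t<e. g j s t) = (\<Sum>s<e. \<Sum>j<e. \<Sum>t<e. g j s t)" by (rule sum.swap)
      also have "\<dots> = (\<Sum>s<e. \<Sum>t<e. \<Sum>j<e. g j s t)" by (intro sum.cong refl sum.swap)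
      finally show ?thesis .
    qed
    let ?g = "\<lambda>i j s t. of_int (A $$ (s, t)) * (x ^ i * (y ^ j * of_int (B $$ (\<sigma> s i, \<sigma> t j))))"
    have "(\<Sum>i<e. \<Sum>j<e. \<Sum>s<e. \<Sum>t<e. ?g i j s t) = (\<Sum>i<e. \<Sum>s<e. \<Sum>t<e. \<Sum>j<e. ?g i j s t)"
      by (intro sum.cong refl swap)
    also have "\<dots> = (\<Sum>s<e. \<Sum>t<e. \<Sum>i<e. \<Sum>j<e. ?g i j s t)" by (rule swap)
    finally show ?thesis .
  qed
  also have "\<dots> = (\<Sum>s<e. \<Sum>t<e. of_int (A $$ (s, t)) * x ^ s * y ^ t * dft2 e B x y)"
  proof (intro sum.cong refl)
    fix s t assume st: "s \<in> {..<e}" "t \<in> {..<e}"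
    have "(\<Sum>i<e. \<Sum>j<e. of_int (A $$ (s, t)) * (x ^ i * (y ^ j * of_int (B $$ (\<sigma> s i, \<sigma> t j))))) =
        of_int (A $$ (s, t)) * (\<Sum>i<e. x ^ i * (\<Sum>j<e. y ^ j * of_int (B $$ (\<sigma> s i, \<sigma> t j))))"
      by (simp add: sum_distrib_left)
    also have "(\<Sum>i<e. x ^ i * (\<Sum>j<e. y ^ j * of_int (B $$ (\<sigma> s i, \<sigma> t j)))) =
        (\<Sum>i<e. x ^ i * (y ^ t * (\<Sum>j<e. y ^ j * of_int (B $$ (\<sigma> s i, j)))))"
      using st assms by (subst shift) auto
    also have "\<dots> = x ^ s * (\<Sum>i<e. x ^ i * (y ^ t * (\<Sum>j<e. y ^ j * of_int (B $$ (i, j)))))"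
      using st assms by (subst shift) auto
    also have "\<dots> = x ^ s * y ^ t * dft2 e B x y"
      by (simp add: dft2_def sum_distrib_left mult_ac)
    finally show "(\<Sum>i<e. \<Sum>j<e. of_int (A $$ (s, t)) * (x ^ i * (y ^ j * of_int (B $$ (\<sigma> s i, \<sigma> t j))))) =
        of_int (A $$ (s, t)) * x ^ s * y ^ t * dft2 e B x y"
      by simp
  qed
  also have "\<dots> = dft2 e A x y * dft2 e B x y"
    by (simp add: dft2_def[of e A] sum_distrib_right)
  finally show ?thesis .
qed

lemma comp_power_carrier:
  assumes "A \<in> carrier_mat e e"
  shows "comp_power e A n \<in> carrier_mat e e"
  using assms by (induction e A n rule: comp_power.induct) (auto simp: d_comp_def)

lemma dft2_comp_power:
  assumes "x ^ e = 1" "y ^ e = 1" "n \<ge> 1"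
  shows "dft2 e (comp_power e A n) x y = dft2 e A x y ^ n"
  using assms by (induction e A n rule: comp_power.induct) (auto simp: dft2_d_comp)

lemma cis_eq_1_iff_less:
  assumes "j < p"
  shows "cis (2 * pi * real j / real p) = 1 \<longleftrightarrow> j = 0"
proof -
  have "inj_on (\<lambda>k. cis (2 * pi * real k / real p)) {..<p}"
    using assms bij_betw_roots_unity[of p] by (auto simp: bij_betw_def)
  from inj_on_eq_iff[OF this, of j 0] show ?thesis using assms by simp
qed

lemma cis_mod:
  assumes "p > 0"
  shows "cis (2 * pi * real (j mod p) / real p) = cis (2 * pi * real j / real p)"
proof -
  have "real j = real p * real (j div p) + real (j mod p)"
    by (metis mult_div_mod_eq of_nat_add of_nat_mult)
  hence "2 * pi * real j / real p = 2 * pi * real (j mod p) / real p + 2 * pi * real (j div p)"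
    using assms by (simp add: field_simps)
  thus ?thesis by (simp add: cis_mult[symmetric] cis_multiple_2pi)
qed

section \<open>Gaussian periods and cyclotomic numbers\<close>

text \<open>The cardinality assumption says that X^(p^m) - X has all its roots in the ambient field.
  The locale can thus be instantiated for the base field and for the extension inside the same
  type.\<close>

locale cyclotomy =
  fixes p m e :: nat and \<beta> :: "'K::{finite,field}"
  assumes prime_p: "prime p" and char: "CHAR('K) = p" and m_pos: "m \<ge> 1" and e_pos: "e \<ge> 1"
    and e_dvd: "e dvd p ^ m - 1"
    and gen: "is_generator p m \<beta>"
    and card_subfield: "card (subfield_pm p m :: 'K set) = p ^ m"
begin

abbreviation F :: "'K set" where "F \<equiv> subfield_pm p m"
abbreviation f :: nat where "f \<equiv> f_of p m e"
abbreviation \<eta> :: "nat \<Rightarrow> complex" where "\<eta> \<equiv> gauss_period p m e \<beta>"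

definition \<psi> :: "'K \<Rightarrow> complex" where
  "\<psi> x = cis (2 * pi * real (to_Zp p (trace_pm p m x)) / real p)"

lemma p_ge_2: "p \<ge> 2" by (rule prime_ge_2_nat[OF prime_p])

lemma power_p_add: "(x + y :: 'K) ^ (p ^ k) = x ^ (p ^ k) + y ^ (p ^ k)"
  by (rule freshmans_dream') (use prime_p char in auto)

lemma power_p_sum: "sum g A ^ (p ^ k) = (\<Sum>i\<in>A. (g i :: 'K) ^ (p ^ k))"
  by (rule freshmans_dream_sum') (use prime_p char in auto)

lemma card_ge_2: "p ^ m \<ge> 2"
  using power_increasing[of 1 m p] p_ge_2 m_pos by simp

lemma e_times_f: "e * f = p ^ m - 1"
  using e_dvd by (simp add: f_of_def)

lemma f_pos: "f > 0"
  using e_times_f card_ge_2 by (cases "f = 0") auto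

lemma subfield_closed:
  "x \<in> F \<Longrightarrow> y \<in> F \<Longrightarrow> x + y \<in> F" "x \<in> F \<Longrightarrow> y \<in> F \<Longrightarrow> x * y \<in> F"
  "0 \<in> F" "1 \<in> F" "x \<in> F \<Longrightarrow> x ^ k \<in> F"
proof -
  show "x ^ k \<in> F" if "x \<in> F"
  proof -
    have "(x ^ k) ^ (p ^ m) = (x ^ (p ^ m)) ^ k" by (simp only: power_mult[symmetric] mult.commute)
    thus ?thesis using that by (simp add: subfield_pm_def)
  qed
qed (use p_ge_2 in \<open>auto simp: subfield_pm_def power_p_add power_mult_distrib power_0_left\<close>)

lemma gen_powers: "range (\<lambda>k. \<beta> ^ k) = F - {0}" and gen_in: "\<beta> \<in> F"
  using gen by (auto simp: is_generator_def)

lemma gen_nonzero: "\<beta> \<noteq> 0"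
  using rangeI[of "\<lambda>k. \<beta> ^ k" 1] unfolding gen_powers by simp

lemma gen_power_in: "\<beta> ^ k \<in> F"
  using gen_in by (rule subfield_closed)

lemma gen_order: "\<beta> ^ (p ^ m - 1) = 1"
proof -
  have "\<beta> * \<beta> ^ (p ^ m - 1) = \<beta> ^ Suc (p ^ m - 1)" by simp
  also have "Suc (p ^ m - 1) = p ^ m" using card_ge_2 by simp
  also have "\<beta> ^ (p ^ m) = \<beta>" using gen_in by (simp add: subfield_pm_def)
  finally show ?thesis using gen_nonzero by simp
qed

lemma gen_power_periodic: "\<beta> ^ (k + (p ^ m - 1)) = \<beta> ^ k"
  by (simp only: power_add gen_order mult_1_right)

lemma gen_power_mod: "\<beta> ^ (k mod (p ^ m - 1)) = \<beta> ^ k"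
  by (rule periodic_mod) (rule gen_power_periodic)

text \<open>The exponents below \<open>p ^ m - 1\<close> already reach all of
  \<open>F - {0}\<close>, and equal cardinalities force injectivity.\<close>

lemma bij_gen_powers: "bij_betw (\<lambda>k. \<beta> ^ k) {..<p ^ m - 1} (F - {0})"
proof -
  have pos: "p ^ m - 1 > 0" using card_ge_2 by simp
  have img: "(\<lambda>k. \<beta> ^ k) ` {..<p ^ m - 1} = F - {0}"
  proof
    show "F - {0} \<subseteq> (\<lambda>k. \<beta> ^ k) ` {..<p ^ m - 1}"
    proof
      fix x assume "x \<in> F - {0}"
      then obtain k where "x = \<beta> ^ k" unfolding gen_powers[symmetric] by auto
      hence "x = \<beta> ^ (k mod (p ^ m - 1))" by (simp only: gen_power_mod)
      thus "x \<in> (\<lambda>k. \<beta> ^ k) ` {..<p ^ m - 1}" using pos by (intro image_eqI) auto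
    qed
  qed (auto simp flip: gen_powers)
  moreover have "card (F - {0}) = p ^ m - 1"
    using subfield_closed(3) by (simp add: card_Diff_singleton card_subfield)
  ultimately show ?thesis
    unfolding bij_betw_def by (auto intro!: eq_card_imp_inj_on)
qed

lemma gen_power_eq_iff: "\<beta> ^ a = \<beta> ^ b \<longleftrightarrow> a mod (p ^ m - 1) = b mod (p ^ m - 1)"
proof -
  have pos: "p ^ m - 1 > 0" using card_ge_2 by simp
  have "\<beta> ^ a = \<beta> ^ b \<longleftrightarrow> \<beta> ^ (a mod (p ^ m - 1)) = \<beta> ^ (b mod (p ^ m - 1))"
    by (simp only: gen_power_mod)
  also have "\<dots> \<longleftrightarrow> a mod (p ^ m - 1) = b mod (p ^ m - 1)"
    using pos by (intro inj_on_eq_iff[OF bij_betw_imp_inj_on[OF bij_gen_powers]]) auto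
  finally show ?thesis .
qed

section \<open>The prime field, the trace and the additive character\<close>

lemma of_nat_eq_iff_mod: "(of_nat a :: 'K) = of_nat b \<longleftrightarrow> a mod p = b mod p"
  by (simp add: of_nat_eq_iff_cong_CHAR char cong_def)

text \<open>The \<open>p\<close> residues are distinct roots of X^p - X, which leaves no room for
  others.\<close>

lemma power_p_eq_self_iff: "(y::'K) ^ p = y \<longleftrightarrow> (\<exists>j<p. y = of_nat j)"
proof -
  let ?S = "{y::'K. y ^ p = y}"
  have inj: "inj_on (of_nat :: nat \<Rightarrow> 'K) {..<p}"
    unfolding inj_on_def of_nat_eq_iff_mod by simp
  have sub: "of_nat ` {..<p} \<subseteq> ?S"
  proof safe
    fix j show "(of_nat j :: 'K) ^ p = of_nat j"
    proof (induction j)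
      case 0
      show ?case using p_ge_2 by (simp add: power_0_left)
    next
      case (Suc j)
      have "(of_nat (Suc j) :: 'K) ^ p = 1 + of_nat j ^ p"
        using power_p_add[of 1 "of_nat j" 1] by simp
      thus ?case unfolding Suc by simp
    qed
  qed
  have "of_nat ` {..<p} = ?S"
    using card_power_eq_self_le[OF p_ge_2, where ?'a = 'K] sub inj
    by (intro card_seteq) (auto simp: card_image)
  thus ?thesis by (auto simp: set_eq_iff)
qed

lemma of_nat_to_Zp:
  assumes "(y::'K) ^ p = y"
  shows "to_Zp p y < p \<and> of_nat (to_Zp p y) = y"
proof -
  obtain j where j: "j < p" "y = of_nat j" using assms unfolding power_p_eq_self_iff by auto
  hence "\<exists>!j. j < p \<and> of_nat j = y"
    unfolding j(2) of_nat_eq_iff_mod by (intro ex1I[of _ j]) auto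
  thus ?thesis unfolding to_Zp_def by (rule theI')
qed

text \<open>Raising to the power \<open>p\<close> rotates the conjugates. So the trace lies in the
  prime field, where \<open>to_Zp\<close> is meaningful.\<close>

lemma trace_power_p:
  assumes "x \<in> F"
  shows "trace_pm p m x ^ p = trace_pm p m x"
proof -
  have "trace_pm p m x ^ p = (\<Sum>k<m. x ^ (p ^ Suc k))"
    unfolding trace_pm_def using power_p_sum[of "\<lambda>k. x ^ (p ^ k)" "{..<m}" 1]
    by (simp add: mult.commute[of p] power_mult)
  also have "\<dots> = trace_pm p m x"
  proof -
    have "x + (\<Sum>k<m. x ^ (p ^ Suc k)) = (\<Sum>k<Suc m. x ^ (p ^ k))"
      unfolding sum.lessThan_Suc_shift by simp
    also have "\<dots> = trace_pm p m x + x" using assms by (simp add: trace_pm_def subfield_pm_def)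
    finally show ?thesis by simp
  qed
  finally show ?thesis .
qed

lemma trace_add: "trace_pm p m (x + y) = trace_pm p m x + trace_pm p m (y::'K)"
  by (simp add: trace_pm_def power_p_add sum.distrib)

lemma psi_add:
  assumes "x \<in> F" "y \<in> F"
  shows "\<psi> (x + y) = \<psi> x * \<psi> y"
proof -
  define a b where "a = to_Zp p (trace_pm p m x)" "b = to_Zp p (trace_pm p m y)"
  define c where "c = to_Zp p (trace_pm p m (x + y))"
  have "a < p" "of_nat a = trace_pm p m x" "b < p" "of_nat b = trace_pm p m y"
    "c < p" "of_nat c = trace_pm p m (x + y)"
    using of_nat_to_Zp[OF trace_power_p] assms subfield_closed by (auto simp: a_b_def c_def)
  hence "(of_nat c :: 'K) = of_nat (a + b)" "c < p" by (auto simp: trace_add)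
  hence "c = (a + b) mod p" unfolding of_nat_eq_iff_mod by simp
  hence "\<psi> (x + y) = cis (2 * pi * real (a + b) / real p)"
    using cis_mod[of p "a + b"] p_ge_2 by (simp add: \<psi>_def c_def)
  thus ?thesis by (simp add: \<psi>_def a_b_def cis_mult add_divide_distrib ring_distribs)
qed

lemma psi_0: "\<psi> 0 = 1"
  using psi_add[of 0 0] subfield_closed(3) by (simp add: \<psi>_def)

text \<open>If \<psi> were trivial, the trace would vanish on all of \<open>F\<close>; but it is a
  nonzero polynomial of degree at most \<open>p ^ (m - 1)\<close>, less than
  \<open>card F\<close>.\<close>

lemma psi_nontrivial: "\<exists>c\<in>F. \<psi> c \<noteq> 1"
proof (rule ccontr)
  assume "\<not> ?thesis"
  hence triv: "\<psi> x = 1" if "x \<in> F" for x using that by blast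
  have tr: "trace_pm p m x = 0" if "x \<in> F" for x
  proof -
    note z = of_nat_to_Zp[OF trace_power_p[OF that]]
    have "to_Zp p (trace_pm p m x) = 0"
      using triv[OF that] cis_eq_1_iff_less z by (auto simp: \<psi>_def)
    thus ?thesis using z by simp
  qed
  define P :: "'K poly" where "P = (\<Sum>k<m. monom 1 (p ^ k))"
  have inj: "p ^ k = p ^ l \<longleftrightarrow> k = l" for k l using p_ge_2 by (intro power_inject_exp) auto
  have "coeff P (p ^ (m - 1)) = 1"
    using m_pos by (simp add: P_def coeff_sum inj)
  hence P0: "P \<noteq> 0" by auto
  have "degree P \<le> p ^ (m - 1)"
    unfolding P_def
  proof (rule degree_sum_le)
    fix k assume "k \<in> {..<m}"
    thus "degree (monom (1::'K) (p ^ k)) \<le> p ^ (m - 1)"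
      using p_ge_2 by (intro order.trans[OF degree_monom_le] power_increasing) auto
  qed simp
  moreover have "F \<subseteq> {x. poly P x = 0}"
    using tr by (auto simp: P_def poly_sum poly_monom trace_pm_def)
  hence "card F \<le> card {x. poly P x = 0}" by (intro card_mono) auto
  ultimately have "p ^ m \<le> p ^ (m - 1)"
    using card_poly_roots_bound[OF P0] card_subfield by simp
  moreover have "p ^ (m - 1) < p ^ m" using p_ge_2 m_pos by (intro power_strict_increasing) auto
  ultimately show False by simp
qed

lemma sum_psi: "(\<Sum>x\<in>F. \<psi> x) = 0"
proof -
  obtain c where c: "c \<in> F" "\<psi> c \<noteq> 1" using psi_nontrivial by blast
  have inj: "inj_on (\<lambda>x. x + c) F" by (auto simp: inj_on_def)
  have "(\<lambda>x. x + c) ` F \<subseteq> F" by (intro image_subsetI subfield_closed(1) c)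
  hence "bij_betw (\<lambda>x. x + c) F F"
    unfolding bij_betw_def using endo_inj_surj[OF finite _ inj] inj by (intro conjI)
  hence "(\<Sum>x\<in>F. \<psi> x) = (\<Sum>x\<in>F. \<psi> (x + c))" by (rule sum.reindex_bij_betw[symmetric])
  also have "\<dots> = \<psi> c * (\<Sum>x\<in>F. \<psi> x)"
    using c by (simp add: psi_add sum_distrib_left mult.commute)
  finally have "\<psi> c * (\<Sum>x\<in>F. \<psi> x) = (\<Sum>x\<in>F. \<psi> x)" ..
  thus ?thesis using c by simp
qed

section \<open>Periods as coset sums and their Fourier transform\<close>

lemma period_eq: "\<eta> i = (\<Sum>j<f. \<psi> (\<beta> ^ (e * j + i)))"
  by (simp add: gauss_period_def \<psi>_def)

text \<open>Raising \<open>j\<close> by \<open>f\<close> raises the exponent by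
  \<open>e * f = p ^ m - 1\<close>, so the summand has period \<open>f\<close> in
  \<open>j\<close>.\<close>

lemma coset_power_shift:
  "(\<Sum>j<f. h (\<beta> ^ (e * (j + w) + i)) :: complex) = (\<Sum>j<f. h (\<beta> ^ (e * j + i)))"
proof (rule sum_periodic_shift)
  fix j
  have "e * (j + f) + i = (e * j + i) + (p ^ m - 1)" unfolding e_times_f[symmetric] by (simp add: algebra_simps)
  thus "h (\<beta> ^ (e * (j + f) + i)) = h (\<beta> ^ (e * j + i))" by (simp only: gen_power_periodic)
qed

lemma period_periodic: "\<eta> (i + e) = \<eta> i"
proof -
  have "\<eta> (i + e) = (\<Sum>j<f. \<psi> (\<beta> ^ (e * (j + 1) + i)))"
    unfolding period_eq by (simp add: algebra_simps)
  thus ?thesis unfolding coset_power_shift period_eq .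
qed

definition gauss_sum :: "complex \<Rightarrow> complex" where
  "gauss_sum z = (\<Sum>i<e. z ^ i * \<eta> i)"

text \<open>Division with remainder by \<open>e\<close> writes each exponent uniquely as
  \<open>e * j + i\<close>.\<close>

lemma sum_coset_decomp:
  "(\<Sum>j<f. \<Sum>i<e. h (e * j + i) :: 'b::comm_monoid_add) = (\<Sum>k<p ^ m - 1. h k)"
proof -
  have "(\<Sum>j<f. \<Sum>i<e. h (e * j + i)) = (\<Sum>j<f. sum h {j * e..<j * e + e})"
  proof (rule sum.cong[OF refl])
    fix j
    show "(\<Sum>i<e. h (e * j + i)) = sum h {j * e..<j * e + e}"
      by (rule sum.reindex_bij_witness[of _ "\<lambda>k. k - j * e" "\<lambda>i. e * j + i"]) (auto simp: mult.commute)
  qed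
  also have "\<dots> = (\<Sum>k<f * e. h k)" by (rule sum.nat_group)
  finally show ?thesis by (simp add: e_times_f mult.commute[of f])
qed

lemma gauss_sum_eq:
  assumes "z ^ e = 1"
  shows "gauss_sum z = (\<Sum>k<p ^ m - 1. z ^ k * \<psi> (\<beta> ^ k))"
proof -
  have "gauss_sum z = (\<Sum>i<e. \<Sum>j<f. z ^ (e * j + i) * \<psi> (\<beta> ^ (e * j + i)))"
    using assms by (simp add: gauss_sum_def period_eq sum_distrib_left power_add power_mult)
  also have "\<dots> = (\<Sum>j<f. \<Sum>i<e. z ^ (e * j + i) * \<psi> (\<beta> ^ (e * j + i)))" by (rule sum.swap)
  also have "\<dots> = (\<Sum>k<p ^ m - 1. z ^ k * \<psi> (\<beta> ^ k))" by (rule sum_coset_decomp)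
  finally show ?thesis .
qed

text \<open>All periods together sum \<psi> over the nonzero elements, and the sum over
  \<open>F\<close> is 0 while \<open>\<psi> 0 = 1\<close>.\<close>

lemma sum_periods: "(\<Sum>j<e. \<eta> (j + a)) = -1"
proof -
  have "(\<Sum>j<e. \<eta> (j + a)) = gauss_sum 1"
    by (subst sum_periodic_shift) (simp_all add: period_periodic gauss_sum_def)
  also have "\<dots> = (\<Sum>k<p ^ m - 1. \<psi> (\<beta> ^ k))" by (simp add: gauss_sum_eq)
  also have "\<dots> = (\<Sum>x\<in>F - {0}. \<psi> x)" by (rule sum.reindex_bij_betw[OF bij_gen_powers])
  also have "\<dots> = -1" using sum_psi subfield_closed(3) by (simp add: sum_diff1 psi_0)
  finally show ?thesis .
qed

section \<open>Cosets of e-th powers and cyclotomic numbers\<close>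

lemma coset_index_less: "j < e \<Longrightarrow> w < f \<Longrightarrow> e * w + j < p ^ m - 1"
proof -
  assume "j < e" "w < f"
  hence "e * w + j < e * Suc w" "e * Suc w \<le> e * f" by (simp, intro mult_le_mono2 Suc_leI)
  thus ?thesis unfolding e_times_f by linarith
qed

lemma coset_index_unique:
  assumes "\<beta> ^ (e * w + j) = \<beta> ^ (e * w' + j')" "j < e" "j' < e" "w < f" "w' < f"
  shows "w = w' \<and> j = j'"
proof -
  have "e * w + j = e * w' + j'"
    using assms(1) coset_index_less[OF assms(2,4)] coset_index_less[OF assms(3,5)]
    unfolding gen_power_eq_iff by simp
  hence "(e * w + j) div e = (e * w' + j') div e" "(e * w + j) mod e = (e * w' + j') mod e"
    by simp_all
  thus ?thesis using assms e_pos by simp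
qed

lemma coset_index_exists:
  assumes "x \<in> F - {0}"
  obtains w j where "x = \<beta> ^ (e * w + j)" "j < e" "w < f"
proof -
  obtain k where k: "k < p ^ m - 1" "x = \<beta> ^ k"
    using assms bij_gen_powers by (auto simp: bij_betw_def)
  have "k div e < f" using k(1) e_pos unfolding e_times_f[symmetric]
    by (simp add: less_mult_imp_div_less mult.commute)
  thus ?thesis using k e_pos that[of "k div e" "k mod e"] by simp
qed

text \<open>Rewrites a function of the coset of \<open>x\<close> as a sum over all cosets, the form
  in which cyclotomic numbers can be collected.\<close>

lemma sum_coset_indicator:
  assumes "x = \<beta> ^ (e * w0 + j0)" "j0 < e" "w0 < f"
  shows "(\<Sum>j<e. \<Sum>w<f. if x = \<beta> ^ (e * w + j) then g j else (0::complex)) = g j0"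
proof -
  have "x = \<beta> ^ (e * w + j) \<longleftrightarrow> w = w0 \<and> j = j0" if "j < e" "w < f" for j w
    using assms coset_index_unique[OF _ that(1) assms(2) that(2) assms(3)] by auto
  hence "(\<Sum>j<e. \<Sum>w<f. if x = \<beta> ^ (e * w + j) then g j else 0) =
      (\<Sum>j<e. \<Sum>w<f. if w = w0 then if j = j0 then g j0 else 0 else 0)"
    by (intro sum.cong refl) simp
  thus ?thesis using assms by simp
qed

lemma period_dilate:
  assumes "x = \<beta> ^ (e * w + j)"
  shows "(\<Sum>u<f. \<psi> (\<beta> ^ (e * u + a) * x)) = \<eta> (a + j)"
proof -
  have "(\<Sum>u<f. \<psi> (\<beta> ^ (e * u + a) * x)) = (\<Sum>u<f. \<psi> (\<beta> ^ (e * (u + w) + (a + j))))"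
    unfolding assms by (simp add: algebra_simps flip: power_add)
  thus ?thesis unfolding coset_power_shift period_eq .
qed

lemma minus_one_in: "- 1 \<in> F - {0}"
proof -
  have "(-1 :: 'K) ^ (p ^ m) + 1 ^ (p ^ m) = 0"
    using power_p_add[of "-1" 1 m] p_ge_2 by (simp add: power_0_left)
  thus ?thesis by (simp add: subfield_pm_def eq_neg_iff_add_eq_0)
qed

text \<open>In \<open>\<beta> ^ (e * v)\<close> only \<open>v\<close> modulo \<open>f\<close>
  matters, and at most one \<open>v < f\<close> hits -1; hence the indicator is a count.\<close>

lemma D_ind_eq:
  "of_int (D_ind p m e \<beta> i) = (\<Sum>v<f. if 1 + \<beta> ^ (e * v + i) = 0 then 1 else (0::complex))"
proof -
  have iff: "1 + \<beta> ^ k = 0 \<longleftrightarrow> - 1 = \<beta> ^ k" for k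
    by (auto simp: neg_eq_iff_add_eq_0)
  have per: "\<beta> ^ (e * (v mod f) + i) = \<beta> ^ (e * v + i)" for v
  proof (rule periodic_mod[of "\<lambda>v. \<beta> ^ (e * v + i)"])
    fix j
    have "e * (j + f) + i = (e * j + i) + (p ^ m - 1)"
      unfolding e_times_f[symmetric] by (simp add: algebra_simps)
    thus "\<beta> ^ (e * (j + f) + i) = \<beta> ^ (e * j + i)" by (simp only: gen_power_periodic)
  qed
  have ex: "(\<exists>x \<in> F - {0}. - 1 = \<beta> ^ i * x ^ e) \<longleftrightarrow> (\<exists>v<f. - 1 = \<beta> ^ (e * v + i))"
  proof
    assume "\<exists>x \<in> F - {0}. - 1 = \<beta> ^ i * x ^ e"
    then obtain k where "- 1 = \<beta> ^ i * (\<beta> ^ k) ^ e" unfolding gen_powers[symmetric] by auto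
    hence "- 1 = \<beta> ^ (e * (k mod f) + i)" unfolding per by (simp add: power_add mult.commute flip: power_mult)
    thus "\<exists>v<f. - 1 = \<beta> ^ (e * v + i)" using f_pos by (intro exI[of _ "k mod f"]) auto
  next
    assume "\<exists>v<f. - 1 = \<beta> ^ (e * v + i)"
    then obtain v where "- 1 = \<beta> ^ i * (\<beta> ^ v) ^ e"
      by (auto simp: power_add mult.commute simp flip: power_mult)
    thus "\<exists>x \<in> F - {0}. - 1 = \<beta> ^ i * x ^ e" unfolding gen_powers[symmetric] by blast
  qed
  show ?thesis
  proof (cases "\<exists>v<f. - 1 = \<beta> ^ (e * v + i)")
    case True
    then obtain v0 where v0: "v0 < f" "- 1 = \<beta> ^ (e * v0 + i)" by auto
    have uniq: "- 1 = \<beta> ^ (e * v + i) \<longleftrightarrow> v = v0" if "v < f" for v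
    proof
      assume "- 1 = \<beta> ^ (e * v + i)"
      hence "\<beta> ^ (e * v + i) = \<beta> ^ (e * v0 + i)" using v0 by metis
      \<comment> \<open>Here \<open>i\<close> may be \<open>e\<close> or larger, so
        \<open>\<beta> ^ i\<close> is cancelled and uniqueness is used for the coset of index
        0.\<close>
      hence "\<beta> ^ (e * v + 0) * \<beta> ^ i = \<beta> ^ (e * v0 + 0) * \<beta> ^ i" by (simp only: power_add add_0_right)
      hence "\<beta> ^ (e * v + 0) = \<beta> ^ (e * v0 + 0)" using gen_nonzero by simp
      thus "v = v0" using coset_index_unique[of v 0 v0 0] that v0 e_pos by auto
    qed (use v0 in simp)
    have "(\<Sum>v<f. if 1 + \<beta> ^ (e * v + i) = 0 then 1 else (0::complex)) = (\<Sum>v<f. if v = v0 then 1 else 0)"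
      unfolding iff using uniq by (intro sum.cong) auto
    also have "\<dots> = 1" using v0 by simp
    finally show ?thesis using True ex by (simp add: D_ind_def)
  next
    case False
    thus ?thesis unfolding iff using ex by (simp add: D_ind_def)
  qed
qed

lemma cyc_num_eq:
  "of_nat (cyc_num p m e \<beta> i j) =
    (\<Sum>v<f. \<Sum>w<f. if 1 + \<beta> ^ (e * v + i) = \<beta> ^ (e * w + j) then 1 else (0::complex))"
proof -
  have "{(v1, v2). v1 < f \<and> v2 < f \<and> 1 + \<beta> ^ (e * v1 + i) = \<beta> ^ (e * v2 + j)} =
      {z \<in> {..<f} \<times> {..<f}. 1 + \<beta> ^ (e * fst z + i) = \<beta> ^ (e * snd z + j)}" by auto
  hence "of_nat (cyc_num p m e \<beta> i j) =
      (\<Sum>z\<in>{..<f} \<times> {..<f}. if 1 + \<beta> ^ (e * fst z + i) = \<beta> ^ (e * snd z + j) then 1 else (0::complex))"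
    by (simp add: cyc_num_def sum.inter_filter[symmetric])
  thus ?thesis by (simp add: sum.cartesian_product case_prod_unfold)
qed

lemma one_plus_gen_power_in: "1 + \<beta> ^ k \<in> F"
  by (intro subfield_closed gen_power_in)

text \<open>Each term of the product is \<psi> at \<open>\<beta> ^ (e * u + a)\<close> times
  \<open>1 + \<beta> ^ (e * v + i)\<close>. Summed over \<open>u\<close> it gives \<open>f\<close>
  if the second factor is 0, and \<open>\<eta> (a + j)\<close> if that factor lies in the coset of
  index \<open>j\<close>.\<close>

lemma period_mult_cyc_num:
  "\<eta> a * \<eta> (a + i) = of_nat f * of_int (D_ind p m e \<beta> i) +
    (\<Sum>j<e. of_nat (cyc_num p m e \<beta> i j) * \<eta> (a + j))"
proof -
  have T: "(\<Sum>u<f. \<psi> (\<beta> ^ (e * u + a) * (1 + \<beta> ^ (e * v + i)))) =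
      of_nat f * (if 1 + \<beta> ^ (e * v + i) = 0 then 1 else 0) +
      (\<Sum>j<e. \<Sum>w<f. if 1 + \<beta> ^ (e * v + i) = \<beta> ^ (e * w + j) then \<eta> (a + j) else 0)" for v
  proof (cases "1 + \<beta> ^ (e * v + i) = 0")
    case True
    thus ?thesis using gen_nonzero by (auto simp: psi_0)
  next
    case False
    let ?x = "1 + \<beta> ^ (e * v + i)"
    obtain w0 j0 where x: "?x = \<beta> ^ (e * w0 + j0)" "j0 < e" "w0 < f"
      using False one_plus_gen_power_in coset_index_exists[of ?x] by auto
    show ?thesis
      using sum_coset_indicator[OF x, of "\<lambda>j. \<eta> (a + j)"] period_dilate[OF x(1), of a] False
      by simp
  qed
  \<comment> \<open>Shifting the inner sum by \<open>u\<close> creates the common factor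
    \<open>\<beta> ^ (e * u + a)\<close>.\<close>
  have "\<eta> a * \<eta> (a + i) = (\<Sum>u<f. \<psi> (\<beta> ^ (e * u + a)) * (\<Sum>v<f. \<psi> (\<beta> ^ (e * (v + u) + (a + i)))))"
    unfolding coset_power_shift by (simp add: period_eq sum_distrib_right)
  also have "\<dots> = (\<Sum>u<f. \<Sum>v<f. \<psi> (\<beta> ^ (e * u + a) * (1 + \<beta> ^ (e * v + i))))"
    unfolding sum_distrib_left
    by (intro sum.cong refl) (simp add: psi_add[symmetric] gen_power_in algebra_simps flip: power_add)
  also have "\<dots> = (\<Sum>v<f. \<Sum>u<f. \<psi> (\<beta> ^ (e * u + a) * (1 + \<beta> ^ (e * v + i))))" by (rule sum.swap)
  also have "\<dots> = of_nat f * of_int (D_ind p m e \<beta> i) +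
      (\<Sum>v<f. \<Sum>j<e. \<Sum>w<f. if 1 + \<beta> ^ (e * v + i) = \<beta> ^ (e * w + j) then \<eta> (a + j) else 0)"
    unfolding T by (simp only: D_ind_eq sum.distrib sum_distrib_left)
  also have "(\<Sum>v<f. \<Sum>j<e. \<Sum>w<f. if 1 + \<beta> ^ (e * v + i) = \<beta> ^ (e * w + j) then \<eta> (a + j) else 0) =
      (\<Sum>j<e. \<Sum>v<f. \<Sum>w<f. if 1 + \<beta> ^ (e * v + i) = \<beta> ^ (e * w + j) then \<eta> (a + j) else 0)"
    by (rule sum.swap)
  also have "\<dots> = (\<Sum>j<e. of_nat (cyc_num p m e \<beta> i j) * \<eta> (a + j))"
    unfolding cyc_num_eq sum_distrib_right by (intro sum.cong refl) auto
  finally show ?thesis .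
qed

section \<open>The multiplication matrix and period correlations\<close>

abbreviation C :: "int mat" where "C \<equiv> mult_matrix p m e \<beta>"

lemma C_carrier: "C \<in> carrier_mat e e"
  by (simp add: mult_matrix_def)

text \<open>As the periods sum to -1, the constant \<open>f * D\<close> can be spread over them;
  this explains the subtracted term in the matrix.\<close>

lemma period_mult:
  assumes "i < e"
  shows "\<eta> a * \<eta> (a + i) = (\<Sum>j<e. of_int (C $$ (i, j)) * \<eta> (a + j))"
proof -
  have "(\<Sum>j<e. of_int (C $$ (i, j)) * \<eta> (a + j)) =
      (\<Sum>j<e. of_nat (cyc_num p m e \<beta> i j) * \<eta> (a + j)) -
      of_int (D_ind p m e \<beta> i) * of_nat f * (\<Sum>j<e. \<eta> (j + a))"
    using assms by (simp add: mult_matrix_def sum_distrib_left algebra_simps sum_subtractf)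
  thus ?thesis unfolding sum_periods period_mult_cyc_num by simp
qed

text \<open>Every \<open>v\<close> with a nonzero sum contributes exactly one pair of coset index
  and exponent; the exceptional \<open>v\<close> is counted by \<open>D_ind\<close>.\<close>

lemma sum_cyc_num:
  "(\<Sum>j<e. of_nat (cyc_num p m e \<beta> i j) :: complex) = of_nat f - of_int (D_ind p m e \<beta> i)"
proof -
  have "(\<Sum>j<e. of_nat (cyc_num p m e \<beta> i j) :: complex) =
      (\<Sum>v<f. \<Sum>j<e. \<Sum>w<f. if 1 + \<beta> ^ (e * v + i) = \<beta> ^ (e * w + j) then 1 else 0)"
    unfolding cyc_num_eq by (rule sum.swap)
  also have "\<dots> = (\<Sum>v<f. 1 - (if 1 + \<beta> ^ (e * v + i) = 0 then 1 else 0))"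
  proof (rule sum.cong[OF refl])
    fix v
    let ?x = "1 + \<beta> ^ (e * v + i)"
    show "(\<Sum>j<e. \<Sum>w<f. if ?x = \<beta> ^ (e * w + j) then 1 else 0) = 1 - (if ?x = 0 then 1 else (0::complex))"
    proof (cases "?x = 0")
      case True
      thus ?thesis using gen_nonzero by auto
    next
      case False
      then obtain w0 j0 where "?x = \<beta> ^ (e * w0 + j0)" "j0 < e" "w0 < f"
        using one_plus_gen_power_in coset_index_exists[of ?x] by auto
      from sum_coset_indicator[OF this, of "\<lambda>_. 1"] False show ?thesis by simp
    qed
  qed
  also have "\<dots> = of_nat f - of_int (D_ind p m e \<beta> i)"
    unfolding D_ind_eq sum_subtractf by simp
  finally show ?thesis .
qed

text \<open>Summing \<open>period_mult\<close> over \<open>a\<close> leaves minus a row sum of the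
  matrix, which is f - D - Def = f - D p^m.\<close>

lemma period_correlation:
  assumes "i < e"
  shows "(\<Sum>a<e. \<eta> a * \<eta> (a + i)) = of_nat (p ^ m) * of_int (D_ind p m e \<beta> i) - of_nat f"
proof -
  have "(\<Sum>a<e. \<eta> a * \<eta> (a + i)) = (\<Sum>j<e. of_int (C $$ (i, j)) * (\<Sum>a<e. \<eta> (a + j)))"
    unfolding period_mult[OF assms] sum_distrib_left by (rule sum.swap)
  also have "\<dots> = - (\<Sum>j<e. of_int (C $$ (i, j)))"
    unfolding sum_periods by (simp add: sum_negf)
  also have "(\<Sum>j<e. of_int (C $$ (i, j)) :: complex) =
      of_nat f - of_int (D_ind p m e \<beta> i) - of_int (D_ind p m e \<beta> i) * of_nat (e * f)"
    using assms sum_cyc_num[of i] by (simp add: mult_matrix_def sum_subtractf)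
  also have "of_nat (e * f) = (of_nat (p ^ m) - 1 :: complex)"
    unfolding e_times_f using card_ge_2 by (simp add: of_nat_diff)
  finally show ?thesis by (simp add: algebra_simps)
qed

section \<open>Products of Gauss sums and multiplicative characters\<close>

text \<open>For each index \<open>a\<close> of the second factor, the first is started at
  \<open>a\<close>, with \<open>i\<close> the difference of the indices.\<close>

lemma gauss_sum_mult:
  assumes "x ^ e = 1"
  shows "gauss_sum x * gauss_sum y = (\<Sum>i<e. x ^ i * (\<Sum>a<e. (x * y) ^ a * (\<eta> a * \<eta> (a + i))))"
proof -
  have "(\<Sum>i<e. x ^ i * (\<Sum>a<e. (x * y) ^ a * (\<eta> a * \<eta> (a + i)))) =
      (\<Sum>i<e. \<Sum>a<e. y ^ a * \<eta> a * (x ^ a * (x ^ i * \<eta> (i + a))))"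
    by (simp add: sum_distrib_left power_mult_distrib mult_ac add.commute)
  also have "\<dots> = (\<Sum>a<e. \<Sum>i<e. y ^ a * \<eta> a * (x ^ a * (x ^ i * \<eta> (i + a))))" by (rule sum.swap)
  also have "\<dots> = (\<Sum>a<e. y ^ a * \<eta> a * (x ^ a * (\<Sum>i<e. x ^ i * \<eta> (i + a))))"
    by (simp add: sum_distrib_left)
  also have "\<dots> = (\<Sum>a<e. y ^ a * \<eta> a * gauss_sum x)"
    unfolding gauss_sum_def using assms by (subst sum_power_shift) (auto simp: period_periodic)
  also have "\<dots> = gauss_sum x * gauss_sum y"
    unfolding gauss_sum_def[of y] by (simp add: sum_distrib_left mult.commute)
  finally show ?thesis ..
qed

text \<open>The argument of the second Gauss sum is chosen so that \<open>x\<close> cancels from the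
  twist in \<open>a\<close>; only \<open>inverse y\<close> remains once \<open>period_mult\<close>
  is inserted.\<close>

lemma dft2_mult_matrix:
  assumes "x ^ e = 1" "y ^ e = 1"
  shows "gauss_sum x * gauss_sum (inverse (x * y)) = dft2 e C x y * gauss_sum (inverse y)"
proof -
  have nz: "x \<noteq> 0" "y \<noteq> 0" using assms e_pos by (auto simp: power_0_left)
  hence xy: "x * inverse (x * y) = inverse y" by simp
  have shift: "(\<Sum>a<e. inverse y ^ a * \<eta> (a + j)) = y ^ j * gauss_sum (inverse y)" for j
  proof -
    have "inverse y ^ j * (\<Sum>a<e. inverse y ^ a * \<eta> (a + j)) = gauss_sum (inverse y)"
      unfolding gauss_sum_def
      by (rule sum_power_shift) (use assms in \<open>auto simp: period_periodic power_inverse\<close>)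
    hence "y ^ j * inverse y ^ j * (\<Sum>a<e. inverse y ^ a * \<eta> (a + j)) = y ^ j * gauss_sum (inverse y)"
      by (simp only: mult.assoc)
    thus ?thesis using nz by (simp flip: power_mult_distrib)
  qed
  have swap: "(\<Sum>a<e. inverse y ^ a * (\<Sum>j<e. of_int (C $$ (i, j)) * \<eta> (a + j))) =
      (\<Sum>j<e. of_int (C $$ (i, j)) * (\<Sum>a<e. inverse y ^ a * \<eta> (a + j)))" for i
    unfolding sum_distrib_left by (rule trans[OF sum.swap]) (simp only: mult_ac)
  have "gauss_sum x * gauss_sum (inverse (x * y)) =
      (\<Sum>i<e. x ^ i * (\<Sum>a<e. inverse y ^ a * (\<Sum>j<e. of_int (C $$ (i, j)) * \<eta> (a + j))))"
    unfolding gauss_sum_mult[OF assms(1)] xy by (intro sum.cong refl) (simp add: period_mult)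
  also have "\<dots> = (\<Sum>i<e. x ^ i * (\<Sum>j<e. of_int (C $$ (i, j)) * (\<Sum>a<e. inverse y ^ a * \<eta> (a + j))))"
    unfolding swap ..
  also have "\<dots> = dft2 e C x y * gauss_sum (inverse y)"
    unfolding shift by (simp add: dft2_def sum_distrib_left sum_distrib_right mult_ac)
  finally show ?thesis .
qed

text \<open>The product of the values at \<open>z\<close> and \<open>inverse z\<close> follows from
  the period correlations: it is 1 for \<open>z = 1\<close> and otherwise
  \<open>p ^ m * z ^ j0\<close>, where \<open>j0\<close> is the coset index of -1.\<close>

lemma gauss_sum_nonzero:
  assumes "z ^ e = 1"
  shows "gauss_sum z \<noteq> 0"
proof -
  have z0: "z \<noteq> 0" using assms e_pos by (auto simp: power_0_left)
  obtain w0 j0 where j0: "-1 = \<beta> ^ (e * w0 + j0)" "j0 < e" "w0 < f"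
    using coset_index_exists[OF minus_one_in] .
  have "gauss_sum z * gauss_sum (inverse z) =
      (\<Sum>i<e. z ^ i * (of_nat (p ^ m) * of_int (D_ind p m e \<beta> i) - of_nat f))"
    unfolding gauss_sum_mult[OF assms] using z0 by (simp add: period_correlation)
  also have "\<dots> = of_nat (p ^ m) * (\<Sum>i<e. z ^ i * of_int (D_ind p m e \<beta> i)) - of_nat f * (\<Sum>i<e. z ^ i)"
    by (simp add: algebra_simps sum_subtractf sum_distrib_left sum_distrib_right)
  also have "(\<Sum>i<e. z ^ i * of_int (D_ind p m e \<beta> i)) =
      (\<Sum>j<e. \<Sum>w<f. if -1 = \<beta> ^ (e * w + j) then z ^ j else 0)"
    unfolding D_ind_eq sum_distrib_left
    by (intro sum.cong refl) (auto simp: neg_eq_iff_add_eq_0)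
  also have "\<dots> = z ^ j0" by (rule sum_coset_indicator[OF j0])
  finally have eq: "gauss_sum z * gauss_sum (inverse z) = of_nat (p ^ m) * z ^ j0 - of_nat f * (\<Sum>i<e. z ^ i)" .
  show ?thesis
  proof (cases "z = 1")
    case True
    have "gauss_sum z * gauss_sum (inverse z) = of_nat (p ^ m) - of_nat (e * f)"
      using eq unfolding True by (simp add: mult.commute)
    also have "\<dots> = 1" unfolding e_times_f using card_ge_2 by (simp add: of_nat_diff)
    finally show ?thesis by auto
  next
    case False
    hence "(\<Sum>i<e. z ^ i) = 0" using assms by (simp add: sum_gp_strict)
    hence "gauss_sum z * gauss_sum (inverse z) = of_nat (p ^ m) * z ^ j0" using eq by simp
    moreover have "of_nat (p ^ m) * z ^ j0 \<noteq> 0" using z0 p_ge_2 by simp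
    ultimately show ?thesis by auto
  qed
qed

text \<open>The choice of discrete logarithm is harmless when \<open>z ^ e = 1\<close>, as
  \<open>e\<close> divides \<open>p ^ m - 1\<close>. The value at 0 is 0 even for
  \<open>z = 1\<close>.\<close>

definition chi :: "complex \<Rightarrow> 'K \<Rightarrow> complex" where
  "chi z x = (if x = 0 then 0 else z ^ (SOME k. \<beta> ^ k = x))"

lemma chi_gen_power:
  assumes "z ^ e = 1"
  shows "chi z (\<beta> ^ k) = z ^ k"
proof -
  define l where "l = (SOME l. \<beta> ^ l = \<beta> ^ k)"
  have "\<beta> ^ l = \<beta> ^ k" unfolding l_def by (rule someI[of _ k]) simp
  hence "l mod (p ^ m - 1) mod e = k mod (p ^ m - 1) mod e" by (simp only: gen_power_eq_iff)
  hence "l mod e = k mod e" using e_dvd by (simp add: mod_mod_cancel)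
  moreover have "z ^ (i mod e) = z ^ i" for i
    by (rule periodic_mod[of "\<lambda>i. z ^ i"]) (simp add: power_add assms)
  ultimately have "z ^ l = z ^ k" by metis
  thus ?thesis using gen_nonzero by (simp add: chi_def l_def)
qed

lemma chi_mult:
  assumes "z ^ e = 1" "x \<in> F" "y \<in> F"
  shows "chi z (x * y) = chi z x * chi z y"
proof (cases "x = 0 \<or> y = 0")
  case False
  then obtain a b where "x = \<beta> ^ a" "y = \<beta> ^ b" using assms gen_powers by (metis DiffI rangeE singletonD)
  thus ?thesis using assms(1) by (simp add: chi_gen_power power_add flip: power_add)
qed (auto simp: chi_def)

lemma gauss_sum_eq_chi:
  assumes "z ^ e = 1"
  shows "gauss_sum z = (\<Sum>x\<in>F. chi z x * \<psi> x)"
proof -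
  have "gauss_sum z = (\<Sum>k<p ^ m - 1. chi z (\<beta> ^ k) * \<psi> (\<beta> ^ k))"
    by (simp only: gauss_sum_eq assms chi_gen_power)
  also have "\<dots> = (\<Sum>x\<in>F - {0}. chi z x * \<psi> x)" by (rule sum.reindex_bij_betw[OF bij_gen_powers])
  also have "\<dots> = (\<Sum>x\<in>F. chi z x * \<psi> x)"
    by (rule sum.mono_neutral_left) (auto simp: chi_def)
  finally show ?thesis .
qed

text \<open>By \<open>period_mult\<close>, column \<open>a\<close> of \<open>V\<close> is an
  eigenvector for \<open>\<eta> a\<close>, so an invertible \<open>V\<close> diagonalises the
  matrix.\<close>

lemma char_poly_mult_matrix: "char_poly (map_mat of_int C :: complex mat) = period_poly p m e \<beta>"
proof -
  define A :: "complex mat" where "A = map_mat of_int C"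
  define V where "V = mat e e (\<lambda>(j, a). \<eta> (a + j))"
  define D where "D = mat e e (\<lambda>(i, j). if i = j then \<eta> i else 0)"
  have car: "A \<in> carrier_mat e e" "V \<in> carrier_mat e e" "D \<in> carrier_mat e e"
    using C_carrier by (auto simp: A_def V_def D_def)
  have AV: "A * V = V * D"
  proof (rule eq_matI)
    fix i a assume "i < dim_row (V * D)" "a < dim_col (V * D)"
    hence ia: "i < e" "a < e" using car by auto
    have "(A * V) $$ (i, a) = (\<Sum>j<e. of_int (C $$ (i, j)) * \<eta> (a + j))"
      using ia car C_carrier by (simp add: scalar_prod_def A_def V_def lessThan_atLeast0)
    also have "\<dots> = \<eta> (a + i) * \<eta> a" using period_mult[OF ia(1), of a] by (simp add: mult.commute)
    also have "\<dots> = (V * D) $$ (i, a)"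
      using ia car by (simp add: scalar_prod_def V_def D_def if_distrib cong: if_cong)
    finally show "(A * V) $$ (i, a) = (V * D) $$ (i, a)" .
  qed (use car in auto)
  have "det V \<noteq> 0"
  proof
    assume "det V = 0"
    then obtain v where v: "v \<in> carrier_vec e" "v \<noteq> 0\<^sub>v e" "V *\<^sub>v v = 0\<^sub>v e"
      using det_0_iff_vec_prod_zero_field[OF car(2)] by auto
    have row: "(\<Sum>a<e. \<eta> (a + j) * v $ a) = 0" if "j < e" for j
    proof -
      have "(V *\<^sub>v v) $ j = (\<Sum>a<e. \<eta> (a + j) * v $ a)"
        using v(1) that by (simp add: V_def scalar_prod_def lessThan_atLeast0)
      thus ?thesis using v that by simp
    qed
    \<comment> \<open>Transforming the kernel equations over \<open>j\<close> at
      \<open>inverse z\<close> splits off a nonzero Gauss sum, so the transform of \<open>v\<close>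
      vanishes.\<close>
    have "(\<Sum>a<e. v $ a * z ^ a) = 0" if z: "z ^ e = 1" for z
    proof -
      have z0: "z \<noteq> 0" using z e_pos by (auto simp: power_0_left)
      let ?y = "inverse z"
      have y: "?y ^ e = 1" using z by (simp add: power_inverse)
      have shift: "(\<Sum>j<e. ?y ^ j * \<eta> (a + j)) = z ^ a * gauss_sum ?y" for a
      proof -
        have "?y ^ a * (\<Sum>j<e. ?y ^ j * \<eta> (j + a)) = gauss_sum ?y"
          unfolding gauss_sum_def by (rule sum_power_shift) (use y period_periodic in auto)
        hence "z ^ a * ?y ^ a * (\<Sum>j<e. ?y ^ j * \<eta> (j + a)) = z ^ a * gauss_sum ?y"
          by (simp only: mult.assoc)
        thus ?thesis using z0 by (simp add: add.commute flip: power_mult_distrib)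
      qed
      have "0 = (\<Sum>j<e. ?y ^ j * (\<Sum>a<e. \<eta> (a + j) * v $ a))" using row by simp
      also have "\<dots> = (\<Sum>j<e. \<Sum>a<e. v $ a * (?y ^ j * \<eta> (a + j)))"
        by (simp add: sum_distrib_left mult_ac)
      also have "\<dots> = (\<Sum>a<e. \<Sum>j<e. v $ a * (?y ^ j * \<eta> (a + j)))" by (rule sum.swap)
      also have "\<dots> = (\<Sum>a<e. v $ a * z ^ a) * gauss_sum ?y"
        by (simp add: shift sum_distrib_right mult.assoc flip: sum_distrib_left)
      finally show ?thesis using gauss_sum_nonzero[OF y] by simp
    qed
    hence "v $ i = 0" if "i < e" for i using that by (rule dft_eq_0_imp)
    hence "v = 0\<^sub>v e" using v(1) by (intro eq_vecI) auto
    thus False using v(2) by simp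
  qed
  from det_non_zero_imp_unit[OF car(2) this, unfolded Units_def, of "()"]
  obtain W where W: "W \<in> carrier_mat e e" "V * W = 1\<^sub>m e" "W * V = 1\<^sub>m e"
    by (auto simp: ring_mat_def)
  have "A = A * (V * W)" using car W by simp
  also have "\<dots> = A * V * W" using assoc_mult_mat[OF car(1,2) W(1)] by simp
  also have "\<dots> = V * D * W" by (simp only: AV)
  finally have "similar_mat_wit A D V W"
    by (intro similar_mat_witI[of _ _ e]) (use car W in auto)
  hence "similar_mat A D" unfolding similar_mat_def by blast
  hence "char_poly A = char_poly D" by (rule char_poly_similar)
  also have "\<dots> = (\<Prod>a\<leftarrow>diag_mat D. [:- a, 1:])"
    using car by (intro char_poly_upper_triangular[of _ e]) (auto simp: upper_triangular_def D_def)
  also have "diag_mat D = map \<eta> [0..<e]"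
    using car by (auto simp: diag_mat_def D_def intro!: map_cong)
  also have "(\<Prod>a\<leftarrow>map \<eta> [0..<e]. [:- a, 1:]) = period_poly p m e \<beta>"
    using prod.distinct_set_conv_list[of "[0..<e]" "\<lambda>i. [:- \<eta> i, 1:]"]
    by (simp add: period_poly_def o_def atLeast0LessThan)
  finally show ?thesis by (simp add: A_def)
qed

end

section \<open>Field extensions\<close>

text \<open>Multiplication by a nonzero \<open>x\<close> permutes the nonzero elements; comparing
  products gives the relation.\<close>

lemma finite_field_power_card:
  fixes x :: "'K::{finite,field}"
  shows "x ^ card (UNIV :: 'K set) = x"
proof (cases "x = 0")
  case False
  have "card (UNIV :: 'K set) > 0" by (simp add: finite_UNIV_card_ge_0)
  hence c: "Suc (card (UNIV - {0::'K})) = card (UNIV :: 'K set)" by (simp add: card_Diff_singleton)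
  have "(\<Prod>y\<in>UNIV - {0}. y) = (\<Prod>y\<in>UNIV - {0}. x * y)"
    by (rule prod.reindex_bij_witness[of _ "\<lambda>y. x * y" "\<lambda>y. y / x"]) (use False in auto)
  also have "\<dots> = x ^ card (UNIV - {0::'K}) * (\<Prod>y\<in>UNIV - {0}. y)"
    by (simp add: prod.distrib)
  finally have "x ^ card (UNIV - {0::'K}) = 1" by simp
  thus ?thesis using power_Suc[of x "card (UNIV - {0::'K})"] unfolding c by simp
qed (simp add: finite_UNIV_card_ge_0)

lemma CHAR_eq_of_card_prime_power:
  assumes "prime p" "card (UNIV :: 'K::{finite,field} set) = p ^ k"
  shows "CHAR('K) = p"
proof -
  have "prime CHAR('K)"
    using prime_CHAR_semidom[where ?'a = 'K] finite_imp_CHAR_pos[where ?'a = 'K] by simp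
  moreover have "CHAR('K) dvd p ^ k" using CHAR_dvd_CARD[where ?'a = 'K] assms by simp
  ultimately show ?thesis
    using assms(1) by (meson prime_dvd_power primes_dvd_imp_eq)
qed

lemma pred_dvd_power_pred: "q - 1 dvd q ^ n - (1::nat)" if "q \<ge> 1"
proof (induction n)
  case (Suc n)
  have "q * q ^ n \<ge> q" using that by simp
  hence "q ^ Suc n - 1 = q * (q ^ n - 1) + (q - 1)"
    using that unfolding power_Suc diff_mult_distrib2 by linarith
  thus ?case using Suc by simp
qed simp

text \<open>With N = (p^m - 1)/(p^r - 1), the nonzero elements of the subfield are exactly the
  powers of \<open>\<beta> ^ N\<close>.\<close>

lemma (in cyclotomy) card_subfield_of_dvd:
  assumes "m = n * r" "r \<ge> 1"
  shows "card (subfield_pm p r :: 'K set) = p ^ r"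
proof -
  define q1 where "q1 = p ^ r - 1"
  have q: "p ^ r = Suc q1" "q1 > 0"
    using power_increasing[of 1 r p] p_ge_2 assms(2) by (auto simp: q1_def)
  have "q1 dvd (p ^ r) ^ n - 1" unfolding q1_def using p_ge_2 by (intro pred_dvd_power_pred) auto
  moreover have "(p ^ r) ^ n = p ^ m" by (simp only: assms(1) power_mult[symmetric] mult.commute)
  ultimately obtain N where N: "p ^ m - 1 = q1 * N" by (metis dvdE)
  have N0: "N > 0" using N card_ge_2 by (cases N) auto
  have inj: "inj_on (\<lambda>t. \<beta> ^ (N * t)) {..<q1}"
  proof (rule inj_onI)
    fix s t assume st: "s \<in> {..<q1}" "t \<in> {..<q1}" "\<beta> ^ (N * s) = \<beta> ^ (N * t)"
    have "N * s < q1 * N" "N * t < q1 * N" using st N0 by auto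
    hence "N * s = N * t" using st(3) unfolding gen_power_eq_iff N by simp
    thus "s = t" using N0 by simp
  qed
  have "subfield_pm p r - {0} = (\<lambda>t. \<beta> ^ (N * t)) ` {..<q1}"
  proof (intro equalityI subsetI)
    fix x :: 'K assume x: "x \<in> subfield_pm p r - {0}"
    have "x \<in> F"
      using x p_ge_2 unfolding assms(1)
    proof (induction n)
      case (Suc n)
      have "x ^ (p ^ (Suc n * r)) = (x ^ (p ^ r)) ^ (p ^ (n * r))"
        by (simp add: power_add power_mult)
      thus ?case using Suc by (simp add: subfield_pm_def)
    qed (simp add: subfield_pm_def)
    then obtain k where k: "k < p ^ m - 1" "x = \<beta> ^ k"
      using x bij_gen_powers by (auto simp: bij_betw_def)
    have "x ^ q1 = 1" using x q by (auto simp: subfield_pm_def)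
    hence "\<beta> ^ (k * q1) = \<beta> ^ 0" using k by (simp add: power_mult)
    hence "q1 * N dvd k * q1" unfolding gen_power_eq_iff N by (simp add: mod_eq_0_iff_dvd)
    hence "N dvd k" using q by simp
    then obtain t where "k = N * t" by auto
    moreover from this have "t < q1" using k(1) N0 unfolding N by simp
    ultimately show "x \<in> (\<lambda>t. \<beta> ^ (N * t)) ` {..<q1}" using k by auto
  next
    fix x assume "x \<in> (\<lambda>t. \<beta> ^ (N * t)) ` {..<q1}"
    then obtain t where t: "x = \<beta> ^ (N * t)" by auto
    have "x ^ (p ^ r) = \<beta> ^ (N * t) * (\<beta> ^ (q1 * N)) ^ t"
      unfolding t q by (simp add: power_mult[symmetric] mult_ac)
    also have "\<dots> = x" using gen_order t unfolding N by simp
    finally show "x \<in> subfield_pm p r - {0}" using t gen_nonzero by (simp add: subfield_pm_def)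
  qed
  hence "card (subfield_pm p r - {0::'K}) = q1" using inj by (simp add: card_image)
  moreover have "(0::'K) \<in> subfield_pm p r" using q by (simp add: subfield_pm_def)
  ultimately show ?thesis using q by (simp add: card_Diff_singleton)
qed

text \<open>The \<open>N\<close> roots already present exhaust those possible in the closure. This
  identifies fixed points there with elements of the original field.\<close>

lemma power_eq_self_alg_closure:
  assumes "N \<ge> 2" "card {x::'K::{finite,field}. x ^ N = x} = N"
  shows "{x::'K alg_closure. x ^ N = x} = to_ac ` {x. x ^ N = x}"
proof -
  have "to_ac ` {x::'K. x ^ N = x} \<subseteq> {x. x ^ N = x}" by (auto simp flip: to_ac_power)
  moreover have "card (to_ac ` {x::'K. x ^ N = x}) = N"
    using assms by (subst card_image) (auto intro: inj_on_subset[OF inj_to_ac])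
  ultimately show ?thesis
    using card_power_eq_self_le[OF assms(1), where ?'a = "'K alg_closure"]
    by (intro card_seteq[symmetric]) auto
qed

text \<open>Transitivity of the trace: the exponents \<open>r * i + k\<close> with
  \<open>k < r\<close>, \<open>i < n\<close> run once through those below
  \<open>n * r\<close>.\<close>

lemma trace_pm_trans:
  assumes "\<And>(g :: nat \<Rightarrow> 'K::{finite,field}) A k. sum g A ^ (p ^ k) = (\<Sum>i\<in>A. g i ^ (p ^ k))"
  shows "trace_pm p r (\<Sum>i<n. x ^ ((p ^ r) ^ i)) = trace_pm p (n * r) (x :: 'K)"
proof -
  have "trace_pm p r (\<Sum>i<n. x ^ ((p ^ r) ^ i)) = (\<Sum>k<r. \<Sum>i<n. x ^ (p ^ (r * i + k)))"
    unfolding trace_pm_def assms by (simp add: power_mult power_add)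
  also have "\<dots> = (\<Sum>i<n. \<Sum>k<r. x ^ (p ^ (r * i + k)))" by (rule sum.swap)
  also have "\<dots> = (\<Sum>i<n. \<Sum>k\<in>{i * r..<i * r + r}. x ^ (p ^ k))"
  proof (rule sum.cong[OF refl])
    fix i
    show "(\<Sum>k<r. x ^ (p ^ (r * i + k))) = (\<Sum>k\<in>{i * r..<i * r + r}. x ^ (p ^ k))"
      by (rule sum.reindex_bij_witness[of _ "\<lambda>k. k - i * r" "\<lambda>k. r * i + k"]) (auto simp: mult.commute)
  qed
  also have "\<dots> = trace_pm p (n * r) x" unfolding trace_pm_def by (rule sum.nat_group)
  finally show ?thesis .
qed

section \<open>Lifting Gauss sums to the extension\<close>

locale cyclotomy_extension =
  R: cyclotomy p r e gam + N: cyclotomy p "n * r" e lam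
  for p r n e :: nat and gam lam :: "'K::{finite,field}" +
  assumes n_pos: "n \<ge> 1" and card_UNIV: "card (UNIV :: 'K set) = p ^ (n * r)"
    and norm_gen: "\<exists>y \<in> subfield_pm p r - {0}. norm_rel p r n lam * inverse gam = y ^ e"
begin

text \<open>Compatibility of the generators makes the norm of \<open>lam\<close> equal to
  \<open>gam ^ (t * e + 1)\<close>, so norms preserve discrete logarithms modulo
  \<open>e\<close>.\<close>

lemma chi_norm:
  assumes "z ^ e = 1"
  shows "R.chi z (norm_rel p r n (lam ^ k)) = z ^ k"
proof -
  obtain t where t: "norm_rel p r n lam * inverse gam = (gam ^ t) ^ e"
    using norm_gen unfolding R.gen_powers[symmetric] by auto
  have "norm_rel p r n lam = (norm_rel p r n lam * inverse gam) * gam" using R.gen_nonzero by simp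
  also have "\<dots> = gam ^ (t * e + 1)" unfolding t by (simp flip: power_mult)
  finally have nl: "norm_rel p r n lam = gam ^ (t * e + 1)" .
  have "norm_rel p r n (lam ^ k) = norm_rel p r n lam ^ k"
    by (simp add: norm_rel_def prod_power_distrib mult.commute flip: power_mult)
  also have "\<dots> = gam ^ ((t * e + 1) * k)" unfolding nl by (simp only: power_mult)
  finally have "R.chi z (norm_rel p r n (lam ^ k)) = z ^ ((t * e + 1) * k)"
    using R.chi_gen_power[OF assms] by simp
  also have "(t * e + 1) * k = e * (t * k) + k" by (simp add: algebra_simps)
  finally show ?thesis by (simp add: power_add power_mult assms)
qed

text \<open>Hasse-Davenport is applied in the algebraic closure, where polynomials split. The fixed
  points of the powers \<open>p ^ r\<close> and \<open>p ^ (n * r)\<close> there are the images of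
  the base field and of the whole type.\<close>

lemma gauss_sum_lift:
  assumes "z ^ e = 1"
  shows "N.gauss_sum z = (-1) ^ (n - 1) * R.gauss_sum z ^ n"
proof -
  let ?q = "p ^ r"
  have char: "CHAR('K alg_closure) = p" using R.char by simp
  have q_add: "(x + y :: 'K alg_closure) ^ ?q = x ^ ?q + y ^ ?q" for x y
    by (rule freshmans_dream') (use char R.prime_p in auto)
  interpret P: power_endomorphism ?q "TYPE('K alg_closure)"
    by unfold_locales (use R.card_ge_2 q_add in auto)
  have Fix: "P.Fix = to_ac ` R.F"
    using power_eq_self_alg_closure[OF R.card_ge_2] R.card_subfield
    by (simp add: P.Fix_def subfield_pm_def)
  interpret HD: hasse_davenport ?q "TYPE('K alg_closure)" "\<lambda>x. R.chi z (of_ac x)" "\<lambda>x. R.\<psi> (of_ac x)"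
  proof
    show "\<exists>c\<in>P.Fix. R.\<psi> (of_ac c) \<noteq> 1" using R.psi_nontrivial by (auto simp: Fix)
    show "R.chi z (of_ac 1) = 1"
      using R.chi_gen_power[OF assms, of 0] of_ac_to_ac[of "1::'K"] by simp
  qed (auto simp: Fix R.chi_mult[OF assms] R.psi_add R.psi_0 simp flip: to_ac_mult to_ac_add)
  have "p ^ (n * r) = ?q ^ n" by (simp only: power_mult[symmetric] mult.commute)
  hence all: "{x::'K alg_closure. x ^ (?q ^ n) = x} = range to_ac"
    using power_eq_self_alg_closure[of "p ^ (n * r)", where ?'K = 'K] N.card_ge_2
      finite_field_power_card[where ?'K = 'K] card_UNIV by simp
  have "N.gauss_sum z = (\<Sum>k<p ^ (n * r) - 1. R.chi z (norm_rel p r n (lam ^ k)) * N.\<psi> (lam ^ k))"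
    by (simp only: N.gauss_sum_eq[OF assms] chi_norm[OF assms])
  also have "\<dots> = (\<Sum>x\<in>N.F - {0}. R.chi z (norm_rel p r n x) * N.\<psi> x)"
    by (rule sum.reindex_bij_betw[OF N.bij_gen_powers])
  \<comment> \<open>Zero may be added, because its norm is 0 and \<open>R.chi z\<close> vanishes
    there.\<close>
  also have "\<dots> = (\<Sum>x\<in>UNIV. R.chi z (norm_rel p r n x) * N.\<psi> x)"
  proof (rule sum.mono_neutral_left)
    have "N.F = UNIV" using finite_field_power_card[where ?'K = 'K] by (auto simp: subfield_pm_def card_UNIV)
    moreover have "norm_rel p r n (0::'K) = 0" using n_pos R.p_ge_2 by (auto simp: norm_rel_def power_0_left)
    ultimately show "\<forall>x\<in>UNIV - (N.F - {0}). R.chi z (norm_rel p r n x) * N.\<psi> x = 0"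
      by (auto simp: R.chi_def)
  qed auto
  also have "\<dots> = (\<Sum>x\<in>UNIV. R.chi z (\<Prod>i<n. x ^ (?q ^ i)) * R.\<psi> (\<Sum>i<n. x ^ (?q ^ i)))"
    unfolding R.\<psi>_def N.\<psi>_def trace_pm_trans[OF R.power_p_sum]
    by (simp add: norm_rel_def power_mult)
  also have "\<dots> = (\<Sum>x | x ^ (?q ^ n) = x. R.chi z (of_ac (\<Prod>i<n. x ^ (?q ^ i))) * R.\<psi> (of_ac (\<Sum>i<n. x ^ (?q ^ i))))"
    unfolding all by (simp add: sum.reindex[OF inj_to_ac] flip: to_ac_power to_ac_sum to_ac_prod)
  also have "\<dots> = (-1) ^ (n - 1) * (\<Sum>x\<in>P.Fix. R.chi z (of_ac x) * R.\<psi> (of_ac x)) ^ n"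
    by (rule HD.hasse_davenport[OF n_pos])
  also have "(\<Sum>x\<in>P.Fix. R.chi z (of_ac x) * R.\<psi> (of_ac x)) = R.gauss_sum z"
    unfolding Fix R.gauss_sum_eq_chi[OF assms]
    by (subst sum.reindex) (auto intro: inj_on_subset[OF inj_to_ac])
  finally show ?thesis .
qed

lemma mult_matrix_eq: "N.C = (-1) ^ (n - 1) \<cdot>\<^sub>m comp_power e R.C n"
proof (rule mat_eqI_dft2[of _ e])
  fix x y :: complex assume xy: "x ^ e = 1" "y ^ e = 1"
  have roots: "inverse y ^ e = 1" "inverse (x * y) ^ e = 1"
    using xy by (auto simp: power_inverse power_mult_distrib)
  have "dft2 e N.C x y * N.gauss_sum (inverse y) = N.gauss_sum x * N.gauss_sum (inverse (x * y))"
    using N.dft2_mult_matrix[OF xy] by simp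
  \<comment> \<open>Both lifted Gauss sums bring a sign; one is absorbed when the Gauss sum at
    \<open>inverse y\<close> is lifted back, the other remains.\<close>
  also have "\<dots> = (-1) ^ (n - 1) * ((-1) ^ (n - 1) * (R.gauss_sum x * R.gauss_sum (inverse (x * y))) ^ n)"
    unfolding gauss_sum_lift[OF xy(1)] gauss_sum_lift[OF roots(2)] power_mult_distrib by (simp only: mult_ac)
  also have "\<dots> = (-1) ^ (n - 1) * dft2 e R.C x y ^ n * N.gauss_sum (inverse y)"
    unfolding R.dft2_mult_matrix[OF xy] gauss_sum_lift[OF roots(1)] power_mult_distrib by (simp only: mult_ac)
  finally have "dft2 e N.C x y = (-1) ^ (n - 1) * dft2 e R.C x y ^ n"
    using N.gauss_sum_nonzero[OF roots(1)] by simp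
  also have "\<dots> = (-1) ^ (n - 1) * dft2 e (comp_power e R.C n) x y"
    using xy n_pos by (simp add: dft2_comp_power)
  also have "\<dots> = dft2 e ((-1) ^ (n - 1) \<cdot>\<^sub>m comp_power e R.C n) x y"
    using comp_power_carrier[OF R.C_carrier, of n]
    by (simp add: dft2_def sum_distrib_left mult_ac)
  finally show "dft2 e N.C x y = dft2 e ((-1) ^ (n - 1) \<cdot>\<^sub>m comp_power e R.C n) x y" .
qed (use N.C_carrier comp_power_carrier[OF R.C_carrier] in auto)

end

theorem theorem1p4:
  fixes e p r n :: nat and gam lam :: "'K::{finite,field}"
  assumes "e \<ge> 2" and "prime p" and "r \<ge> 1" and "p ^ r mod e = 1"
    and "n \<ge> 1"
    and "card (UNIV :: 'K set) = p ^ (n * r)"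
    and "is_generator p r gam"
    and "is_generator p (n * r) lam"
    and "\<exists>y \<in> subfield_pm p r - {0}. norm_rel p r n lam * inverse gam = y ^ e"
  shows "mult_matrix p (n * r) e lam = ((-1) ^ (n - 1)) \<cdot>\<^sub>m comp_power e (mult_matrix p r e gam) n
    \<and> period_poly p (n * r) e lam
        = char_poly ((of_int ((-1) ^ (n - 1)) :: complex) \<cdot>\<^sub>m map_mat of_int (comp_power e (mult_matrix p r e gam) n))"
proof -
  have char: "CHAR('K) = p" using CHAR_eq_of_card_prime_power assms(2,6) by blast
  have dvd_r: "e dvd p ^ r - 1" using assms(4) by (metis dvd_minus_mod)
  also have "p ^ r - 1 dvd p ^ (n * r) - 1"
    using pred_dvd_power_pred[of "p ^ r" n] prime_gt_0_nat[OF assms(2)]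
    by (simp only: power_mult[symmetric] mult.commute[of r]) simp
  finally have dvd_nr: "e dvd p ^ (n * r) - 1" .
  have "subfield_pm p (n * r) = (UNIV :: 'K set)"
    using finite_field_power_card[where ?'K = 'K] assms(6) by (auto simp: subfield_pm_def)
  \<comment> \<open>The extension comes first, since its generator is what yields the cardinality of
    the base field.\<close>
  then interpret N: cyclotomy p "n * r" e lam
    by unfold_locales (use assms char dvd_nr in auto)
  interpret R: cyclotomy p r e gam
    by unfold_locales (use assms char dvd_r N.card_subfield_of_dvd[of n r] in auto)
  interpret cyclotomy_extension p r n e gam lam
    by unfold_locales (use assms in auto)
  have "map_mat of_int N.C = (of_int ((-1) ^ (n - 1)) :: complex) \<cdot>\<^sub>m map_mat of_int (comp_power e R.C n)"
    unfolding mult_matrix_eq by (rule eq_matI) auto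
  thus ?thesis using mult_matrix_eq N.char_poly_mult_matrix by simp
qed

end
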